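(* Let $U=(u_n)_{n\geq 1}$ be a sequence of positive integers and set $U_n=\sum_{i=1}^n u_i$ for all $n\ge0$. Let $(n_i)_{i\ge1}$ be an increasing sequence of positive integers, finite or not, such that $u_{n_i}=1$ for all $i\ge1$. Set $n_0=0$, and let $S=(s_i)_{i\ge1}$ be the sequence in $\mathbb Z_{\ge0}$ with $s_i=1$ if $i=U_{n_j}$ for some $j\ge1$ and $s_i=0$ otherwise. Then \begin{align*} \sum_{\lambda\in \overline{\mathcal{P}}(U)}C(\lambda)q^{|\lambda|_S}&= \prod_{i\geq 1}\Biggl[\frac{1+c_{\overline{n_i}}q^i}{1-c_{n_i}q^{i}}\\ &\quad\cdot \prod_{m=n_{i-1}+1}^{n_i-1}\frac{\overline{\mathcal{E}}_{u_m}(c_{\overline{U_{m-1}+1}}q^{i-1},c_{U_{m-1}+1}q^{i-1},\ldots,c_{\overline{U_{m}-1}}q^{i-1},c_{U_{m}-1}q^{i-1},c_{\overline{U_{m}}}q^{i-1},1)}{(1-c_{U_{m-1}+1}q^{i-1})\cdots(1-c_{U_{m}}q^{i-1})}\Biggr],\\ \sum_{\lambda\in \mathcal{P}(U)}C(\lambda)q^{|\lambda|_S}&= \prod_{i\geq 1}\Biggl[\frac{1}{1-c_{n_i}q^{i}}\cdot \prod_{m=n_{i-1}+1}^{n_i-1}\frac{\mathcal{E}_{u_m}(c_{U_{m-1}+1}q^{i-1},\ldots,c_{U_{m}-1}q^{i-1})}{(1-c_{U_{m-1}+1}q^{i-1})\cdots(1-c_{U_{m}}q^{i-1})}\Biggr],\\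 \sum_{\lambda\in \overline{\mathcal{D}}(U)}C(\lambda)q^{|\lambda|_S}&= \sum_{i\geq 1} \sum_{k=n_{i-1}+1}^{n_i-1} \frac{\overline{\mathcal{E}}_{u_k}(c_{\overline{U_{k-1}+1}}q^{i-1},c_{U_{k-1}+1}q^{i-1},\ldots,c_{\overline{U_{k}-1}}q^{i-1},c_{U_{k}-1}q^{i-1},0,1)}{(1-c_{U_{k-1}+1}q^{i-1})\cdots(1-c_{U_{k}-1}q^{i-1})}\\ &\quad\cdot \prod_{m=n_{i-1}+1}^{k-1}\frac{\overline{\mathcal{E}}_{u_m}(c_{\overline{U_{m-1}+1}}q^{i-1},c_{U_{m-1}+1}q^{i-1},\ldots,c_{\overline{U_{m}}}q^{i-1},c_{U_{m}}q^{i-1})}{(1-c_{U_{m-1}+1}q^{i-1})\cdots(1-c_{U_{m}}q^{i-1})}\\ &\quad\cdot\prod_{j= 1}^{i-1}\Biggl[\frac{(c_{n_j}+c_{\overline{n_j}})q^j}{1-c_{n_j}q^{j}}\prod_{m=n_{j-1}+1}^{n_j-1}\frac{\overline{\mathcal{E}}_{u_m}(c_{\overline{U_{m-1}+1}}q^{j-1},c_{U_{m-1}+1}q^{j-1},\ldots,c_{\overline{U_{m}}}q^{j-1},c_{U_{m}}q^{j-1})}{(1-c_{U_{m-1}+1}q^{j-1})\cdots(1-c_{U_{m}}q^{j-1})}\Biggr]. \end{align*}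
   Context: Over-lined integers: $\overline{\mathbb{Z}_{\geq 1}}=\{\overline1,\overline2,\ldots\}$ is a disjoint copy of $\mathbb{Z}_{\ge 1}$; both $i$ and $\overline i$ have size $i$; sums, differences and multiples use sizes. Order: $0<\overline1<1<\overline2<2<\cdots$. Let $\mathbb P$ be the set of infinite sequences $\lambda=(\lambda_i)_{i\ge1}$ in $\mathbb{Z}_{\geq 0}\sqcup\overline{\mathbb{Z}_{\geq 1}}$ with finitely many nonzero terms such that each $\overline i$ occurs at most once and, if it occurs, it comes after all occurrences of $i$ (sequences need not be monotone). For $\lambda\in\mathbb P$: $|\lambda|_S=\sum_{i\ge1}\lambda_i s_i\in\mathbb Z_{\ge0}$; the conjugate $\tilde\lambda=(\tilde\lambda_i)_{i\ge1}$ is given by: $\tilde\lambda_i$ has size $\#\{j\ge1:\lambda_j\ge\overline i\}$ and is over-lined iff $\overline i$ is a part of $\lambda$. With commuting color indeterminates $c_i,c_{\overline i}$ ($i\ge1$), $C(\lambda)=\prod_{0<\overline i\le M(\lambda)}c_{\tilde\lambda_i}$ where $M(\lambda)=\max_i\lambda_i$ (and $C(\lambda)=1$ for the zero sequence). $\overline{\mathcal P}(U)$ (block over-partitions of type $U$): the $\lambda\in\mathbb P$ such that for all $n\ge1$, $\min\{\lambda_{U_{n-1}+1},\ldots,\lambda_{U_n}\}\ge\max\{\lambda_{U_n+1},\ldots,\lambda_{U_{n+1}}\}$. $\mathcal P(U)$ (block partitions of type $U$): elements of $\overline{\mathcal P}(U)$ with no over-lined parts. $\overline{\mathcal D}(U)$: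 the $\lambda\in\overline{\mathcal P}(U)$ such that for all $n\ge1$, $\min\{\lambda_{U_{n-1}+1},\ldots,\lambda_{U_n}\}-\max\{\lambda_{U_n+1},\ldots,\lambda_{U_{n+1}}\}>0$ (difference of sizes) whenever $\min\{\lambda_{U_{n-1}+1},\ldots,\lambda_{U_n}\}>0$. With $\mathcal S_n$ the symmetric group on $\{1,\ldots,n\}$ and $\chi(A)=1$ if $A$ is true and $0$ otherwise, $$\overline{\mathcal E}_n(x_1,y_1,\ldots,x_n,y_n)=(y_n+x_n)\sum_{\sigma\in\mathcal S_n}\prod_{i=1}^{n-1}\bigl(y_i^{\chi(\sigma(i)>\sigma(i+1))}+x_i\bigr),\qquad \mathcal E_n(y_1,\ldots,y_{n-1})=\sum_{\sigma\in\mathcal S_n}\prod_{i=1}^{n-1}y_i^{\chi(\sigma(i)>\sigma(i+1))}.$$ Empty products equal $1$.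
   Formalization: As printed the identities fail (e.g. n_1=1: the zero sequence is missed in the third). In the factors of block n_i the colors c_{n_i}, c_{\overline{n_i}} are corrected to c_{U_{n_i}}, c_{\overline{U_{n_i}}}, and in the third identity k runs up to n_i instead of n_i-1. *)

theory Defs
  imports "HOL-Analysis.Analysis" "HOL-Library.Multiset" "HOL-Library.Extended_Nat"
    "HOL-Combinatorics.Permutations"
begin

section \<open>Formal power series in arbitrarily many commuting indeterminates\<close>

text \<open>
  The ring of formal power series over the integers in the indeterminates \<open>'v\<close>, infinitely many
  in the application. A monomial is a finite multiset of indeterminates, and a series is an
  arbitrary family of integer coefficients, one for each monomial.
\<close>

typedef 'v mps = "UNIV :: ('v multiset \<Rightarrow> int) set"
  morphisms mps_coeff Abs_mps by simp

setup_lifting type_definition_mps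

lemma mps_eqI: "(\<And>M. mps_coeff f M = mps_coeff g M) \<Longrightarrow> f = g"
  by (simp add: fun_eq_iff flip: mps_coeff_inject)

lemma finite_submultisets: "finite {A :: 'v multiset. A \<subseteq># M}"
proof (induction M)
  case empty
  then show ?case by simp
next
  case (add x M)
  have "A \<in> {A. A \<subseteq># M} \<union> add_mset x ` {A. A \<subseteq># M}" if "A \<subseteq># add_mset x M" for A
  proof (cases "x \<in># A")
    case True
    then obtain B where "A = add_mset x B" by (meson mset_add)
    then show ?thesis using that by auto
  next
    case False
    then have "A \<subseteq># M"
      using that by (metis diff_single_trivial subset_eq_diff_conv add_mset_add_single)
    then show ?thesis by simp
  qed
  then have "{A. A \<subseteq># add_mset x M} \<subseteq> {A. A \<subseteq># M} \<union> add_mset x ` {A. A \<subseteq># M}"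
    by blast
  then show ?case using add by (meson finite_UnI finite_imageI finite_subset)
qed

lemma finite_mset_decomp [simp]: "finite {(A, B). A + B = (M :: 'v multiset)}"
proof (rule finite_subset)
  show "{(A, B). A + B = M} \<subseteq> {A. A \<subseteq># M} \<times> {A. A \<subseteq># M}" by auto
qed (simp add: finite_submultisets)

instantiation mps :: (type) comm_ring_1
begin

lift_definition zero_mps :: "'v mps" is "\<lambda>_. 0" .
lift_definition one_mps :: "'v mps" is "\<lambda>M. if M = {#} then 1 else 0" .
lift_definition plus_mps :: "'v mps \<Rightarrow> 'v mps \<Rightarrow> 'v mps" is "\<lambda>f g M. f M + g M" .
lift_definition minus_mps :: "'v mps \<Rightarrow> 'v mps \<Rightarrow> 'v mps" is "\<lambda>f g M. f M - g M" .
lift_definition uminus_mps :: "'v mps \<Rightarrow> 'v mps" is "\<lambda>f M. - f M" .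
lift_definition times_mps :: "'v mps \<Rightarrow> 'v mps \<Rightarrow> 'v mps" is
  "\<lambda>f g M. \<Sum>(A, B) \<in> {(A, B). A + B = M}. f A * g B" .

instance
proof
  fix a b c :: "'v mps"
  show "a * b * c = a * (b * c)"
  proof (rule mps_eqI)
    fix M
    let ?f = "mps_coeff a" and ?g = "mps_coeff b" and ?h = "mps_coeff c"
    let ?D = "\<lambda>M :: 'v multiset. {(A, B). A + B = M}"
    have "mps_coeff (a * b * c) M = (\<Sum>p\<in>?D M. \<Sum>r\<in>?D (fst p). ?f (fst r) * ?g (snd r) * ?h (snd p))"
      by (simp add: times_mps.rep_eq case_prod_unfold sum_distrib_right)
    also have "\<dots> = (\<Sum>(p, r)\<in>Sigma (?D M) (\<lambda>p. ?D (fst p)). ?f (fst r) * ?g (snd r) * ?h (snd p))"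
      by (subst sum.Sigma) auto
    also have "\<dots> = (\<Sum>(p, r)\<in>Sigma (?D M) (\<lambda>p. ?D (snd p)). ?f (fst p) * (?g (fst r) * ?h (snd r)))"
      by (rule sum.reindex_bij_witness[where
            j = "\<lambda>((x, y), (z, w)). ((z, w + y), (w, y))" and
            i = "\<lambda>((x, y), (z, w)). ((x + z, w), (x, z))"])
         (auto simp: add.assoc mult.assoc)
    also have "\<dots> = (\<Sum>p\<in>?D M. \<Sum>r\<in>?D (snd p). ?f (fst p) * (?g (fst r) * ?h (snd r)))"
      by (subst sum.Sigma) auto
    also have "\<dots> = mps_coeff (a * (b * c)) M"
      by (simp add: times_mps.rep_eq case_prod_unfold sum_distrib_left)
    finally show "mps_coeff (a * b * c) M = mps_coeff (a * (b * c)) M" .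
  qed
  show "a * b = b * a"
    by (rule mps_eqI, simp add: times_mps.rep_eq)
       (rule sum.reindex_bij_witness[where i = prod.swap and j = prod.swap],
         auto simp: add.commute mult.commute)
  show "1 * a = a"
  proof (rule mps_eqI)
    fix M
    have "mps_coeff (1 * a) M
        = (\<Sum>p\<in>{(A, B). A + B = M}. if p = ({#}, M) then mps_coeff a M else 0)"
      unfolding times_mps.rep_eq by (rule sum.cong) (auto simp: one_mps.rep_eq split: if_splits)
    then show "mps_coeff (1 * a) M = mps_coeff a M" by simp
  qed
  show "(a + b) * c = a * c + b * c"
    by (rule mps_eqI)
       (simp add: times_mps.rep_eq plus_mps.rep_eq case_prod_unfold distrib_right sum.distrib)
  show "(0 :: 'v mps) \<noteq> 1"
    by (metis one_mps.rep_eq zero_mps.rep_eq zero_neq_one)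
qed (rule mps_eqI; simp add: plus_mps.rep_eq minus_mps.rep_eq uminus_mps.rep_eq zero_mps.rep_eq)+

end

lift_definition mps_var :: "'v \<Rightarrow> 'v mps" is "\<lambda>v M. if M = {#v#} then 1 else 0" .

text \<open>A fraction \<open>f / g\<close> is \<open>f\<close> times the multiplicative inverse of \<open>g\<close> in the ring of series.\<close>

instantiation mps :: (type) inverse
begin

definition inverse_mps :: "'v mps \<Rightarrow> 'v mps" where
  "inverse_mps g = (if \<exists>h. g * h = 1 then THE h. g * h = 1 else 0)"

definition divide_mps :: "'v mps \<Rightarrow> 'v mps \<Rightarrow> 'v mps" where
  "divide_mps f g = f * inverse g"

instance ..

end

lemma mps_inverse_unique:
  fixes g h :: "'v mps"
  assumes "g * h = 1"
  shows "inverse g = h"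
proof -
  have "h' = h" if "g * h' = 1" for h'
  proof -
    have "h' = h' * (g * h)" using assms by simp
    also have "\<dots> = (g * h') * h" by (simp add: mult_ac)
    finally show ?thesis using that by simp
  qed
  with assms have "(THE h. g * h = 1) = h" by blast
  with assms show ?thesis by (auto simp: inverse_mps_def)
qed

lemma mps_coeff_sum: "mps_coeff (sum f S) M = (\<Sum>x\<in>S. mps_coeff (f x) M)"
  by (induction S rule: infinite_finite_induct) (auto simp: plus_mps.rep_eq zero_mps.rep_eq)

lemma mps_coeff_power_eq_0:
  assumes "mps_coeff f {#} = 0" and "size M < k"
  shows "mps_coeff (f ^ k) M = 0"
  using assms(2)
proof (induction k arbitrary: M)
  case (Suc k)
  have "mps_coeff f A * mps_coeff (f ^ k) B = 0" if "A + B = M" for A B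
  proof (cases "A = {#}")
    case False
    then have "size B < k" using that Suc.prems by (auto simp: nonempty_has_size)
    then show ?thesis using Suc.IH by simp
  qed (use assms(1) in simp)
  then show ?case by (auto simp: times_mps.rep_eq intro!: sum.neutral)
qed simp

lemma mps_right_inverse:
  fixes f :: "'v mps"
  assumes "mps_coeff f {#} = 1"
  shows "f * inverse f = 1"
proof -
  define h where "h = 1 - f"
  have h0: "mps_coeff h {#} = 0" using assms by (simp add: h_def minus_mps.rep_eq one_mps.rep_eq)
  have f: "f = 1 - h" by (simp add: h_def)
  define g where "g = Abs_mps (\<lambda>M. \<Sum>k\<le>size M. mps_coeff (h ^ k) M)"
  have g: "mps_coeff g B = mps_coeff (\<Sum>k\<le>N. h ^ k) B" if "size B \<le> N" for B N
  proof -
    have "mps_coeff g B = (\<Sum>k\<le>size B. mps_coeff (h ^ k) B)"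
      by (simp add: g_def Abs_mps_inverse)
    also have "\<dots> = (\<Sum>k\<le>N. mps_coeff (h ^ k) B)"
      by (rule sum.mono_neutral_left) (use that mps_coeff_power_eq_0[OF h0] in auto)
    finally show ?thesis by (simp add: mps_coeff_sum)
  qed
  have "f * g = 1"
  proof (rule mps_eqI)
    fix M
    have "mps_coeff (f * g) M = mps_coeff (f * (\<Sum>k\<le>size M. h ^ k)) M"
      unfolding times_mps.rep_eq by (rule sum.cong) (auto intro!: g)
    also have "f * (\<Sum>k\<le>size M. h ^ k) = 1 - h ^ Suc (size M)"
      unfolding f by (rule sum_gp_basic)
    also have "mps_coeff \<dots> M = mps_coeff 1 M"
      by (simp add: minus_mps.rep_eq mps_coeff_power_eq_0[OF h0] del: power_Suc)
    finally show "mps_coeff (f * g) M = mps_coeff 1 M" .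
  qed
  then show ?thesis using mps_inverse_unique by metis
qed

text \<open>
  The topology of coefficientwise convergence, i.e. the product topology with respect to the
  discrete topology on the integers; see the lemma \<open>tendsto_mps_iff\<close> below. All infinite sums and
  products of series are taken with respect to it.
\<close>

instantiation mps :: (type) t2_space
begin

definition open_mps :: "'v mps set \<Rightarrow> bool" where
  "open_mps U \<longleftrightarrow>
     (\<forall>f\<in>U. \<exists>K. finite K \<and> (\<forall>g. (\<forall>M\<in>K. mps_coeff g M = mps_coeff f M) \<longrightarrow> g \<in> U))"

instance
proof
  show "open (UNIV :: 'v mps set)" by (auto simp: open_mps_def)
next
  fix S T :: "'v mps set"
  assume S: "open S" and T: "open T"
  show "open (S \<inter> T)"
    unfolding open_mps_def
  proof
    fix f
    assume "f \<in> S \<inter> T"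
    then have f: "f \<in> S" "f \<in> T" by auto
    obtain K where "finite K" "\<forall>g. (\<forall>M\<in>K. mps_coeff g M = mps_coeff f M) \<longrightarrow> g \<in> S"
      using S f(1) by (auto simp: open_mps_def)
    moreover obtain L where "finite L" "\<forall>g. (\<forall>M\<in>L. mps_coeff g M = mps_coeff f M) \<longrightarrow> g \<in> T"
      using T f(2) by (auto simp: open_mps_def)
    ultimately show "\<exists>K. finite K \<and> (\<forall>g. (\<forall>M\<in>K. mps_coeff g M = mps_coeff f M) \<longrightarrow> g \<in> S \<inter> T)"
      by (intro exI[of _ "K \<union> L"]) auto
  qed
next
  fix K :: "'v mps set set"
  assume "\<forall>S\<in>K. open S"
  then show "open (\<Union>K)" unfolding open_mps_def by (metis Union_iff)
next
  fix f g :: "'v mps"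
  assume "f \<noteq> g"
  then obtain M where M: "mps_coeff f M \<noteq> mps_coeff g M" using mps_eqI by blast
  let ?U = "\<lambda>f. {h. \<forall>N\<in>{M}. mps_coeff h N = mps_coeff f N}"
  have "open (?U h)" for h unfolding open_mps_def by (intro ballI exI[of _ "{M}"]) auto
  moreover have "f \<in> ?U f" "g \<in> ?U g" "?U f \<inter> ?U g = {}" using M by auto
  ultimately show "\<exists>U V. open U \<and> open V \<and> f \<in> U \<and> g \<in> V \<and> U \<inter> V = {}"
    by blast
qed

end

lemma open_mps_cylinder:
  "finite K \<Longrightarrow> open {g :: 'v mps. \<forall>M\<in>K. mps_coeff g M = mps_coeff f M}"
  unfolding open_mps_def by (intro ballI exI[of _ K]) auto

lemma tendsto_mps_iff:
  fixes f :: "'a \<Rightarrow> 'v mps"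
  shows "(f \<longlongrightarrow> l) F \<longleftrightarrow> (\<forall>M. \<forall>\<^sub>F x in F. mps_coeff (f x) M = mps_coeff l M)"
proof
  assume *: "(f \<longlongrightarrow> l) F"
  show "\<forall>M. \<forall>\<^sub>F x in F. mps_coeff (f x) M = mps_coeff l M"
  proof
    fix M
    show "\<forall>\<^sub>F x in F. mps_coeff (f x) M = mps_coeff l M"
      using topological_tendstoD[OF * open_mps_cylinder[of "{M}" l]] by simp
  qed
next
  assume *: "\<forall>M. \<forall>\<^sub>F x in F. mps_coeff (f x) M = mps_coeff l M"
  show "(f \<longlongrightarrow> l) F"
  proof (rule topological_tendstoI)
    fix U
    assume "open U" "l \<in> U"
    then obtain K where K: "finite K" "\<forall>g. (\<forall>M\<in>K. mps_coeff g M = mps_coeff l M) \<longrightarrow> g \<in> U"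
      unfolding open_mps_def by blast
    have "\<forall>\<^sub>F x in F. \<forall>M\<in>K. mps_coeff (f x) M = mps_coeff l M"
      using K(1) * by (simp add: eventually_ball_finite_distrib)
    then show "\<forall>\<^sub>F x in F. f x \<in> U"
      by (rule eventually_mono) (use K(2) in blast)
  qed
qed


section \<open>Over-lined integers\<close>

text \<open>
  \<open>Pln k\<close> is the integer \<open>k\<close> and \<open>Ovl k\<close> is its over-lined copy. Over-lined integers are positive,
  so \<open>Ovl 0\<close> is not a legitimate value; it is excluded from all sequences below.
\<close>

datatype part = Pln nat | Ovl nat

fun psize :: "part \<Rightarrow> nat" where
  "psize (Pln k) = k"
| "psize (Ovl k) = k"

fun overlined :: "part \<Rightarrow> bool" where
  "overlined (Pln k) = False"
| "overlined (Ovl k) = True"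

instantiation part :: linorder
begin

definition less_eq_part :: "part \<Rightarrow> part \<Rightarrow> bool" where
  "a \<le> b \<longleftrightarrow> psize a < psize b \<or> (psize a = psize b \<and> (overlined b \<longrightarrow> overlined a))"

definition less_part :: "part \<Rightarrow> part \<Rightarrow> bool" where
  "a < b \<longleftrightarrow> a \<le> b \<and> \<not> b \<le> (a :: part)"

instance
proof
  fix a b :: part
  show "a \<le> b \<Longrightarrow> b \<le> a \<Longrightarrow> a = b"
    by (cases a; cases b) (auto simp: less_eq_part_def)
qed (auto simp: less_eq_part_def less_part_def)

end


section \<open>Block over-partitions\<close>

text \<open>
  Sequences are indexed from 1 as functions on the naturals; the unused entry at index 0 is fixed
  to be zero, so that such functions correspond bijectively to sequences.
\<close>

definition seqs :: "(nat \<Rightarrow> part) set" where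
  "seqs = {l. l 0 = Pln 0 \<and> (\<forall>i. l i \<noteq> Ovl 0) \<and> finite {i. l i \<noteq> Pln 0} \<and>
     (\<forall>k\<ge>1. (\<forall>i j. l i = Ovl k \<and> l j = Ovl k \<longrightarrow> i = j) \<and>
             (\<forall>i j. l i = Ovl k \<and> l j = Pln k \<longrightarrow> j < i))}"

definition weight :: "(nat \<Rightarrow> nat) \<Rightarrow> (nat \<Rightarrow> part) \<Rightarrow> nat" where
  "weight s l = (\<Sum>i | i \<ge> 1 \<and> l i \<noteq> Pln 0. psize (l i) * s i)"

definition conj_part :: "(nat \<Rightarrow> part) \<Rightarrow> nat \<Rightarrow> part" where
  "conj_part l i =
     (if \<exists>j\<ge>1. l j = Ovl i then Ovl else Pln) (card {j. j \<ge> 1 \<and> l j \<ge> Ovl i})"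

datatype indet = Qvar | Colour part

abbreviation qvar :: "indet mps" where "qvar \<equiv> mps_var Qvar"
abbreviation col :: "part \<Rightarrow> indet mps" where "col p \<equiv> mps_var (Colour p)"

definition maxpart :: "(nat \<Rightarrow> part) \<Rightarrow> part" where
  "maxpart l = Max (l ` {1..})"

definition colour :: "(nat \<Rightarrow> part) \<Rightarrow> indet mps" where
  "colour l = (\<Prod>i | Pln 0 < Ovl i \<and> Ovl i \<le> maxpart l. col (conj_part l i))"

text \<open>\<open>psum u m\<close> is $U_m = u_1 + \cdots + u_m$; the value \<open>u 0\<close> is irrelevant.\<close>

definition psum :: "(nat \<Rightarrow> nat) \<Rightarrow> nat \<Rightarrow> nat" where
  "psum u m = (\<Sum>i=1..m. u i)"

definition block_min :: "(nat \<Rightarrow> nat) \<Rightarrow> (nat \<Rightarrow> part) \<Rightarrow> nat \<Rightarrow> part" where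
  "block_min u l m = Min (l ` {psum u (m - 1)<..psum u m})"

definition block_max :: "(nat \<Rightarrow> nat) \<Rightarrow> (nat \<Rightarrow> part) \<Rightarrow> nat \<Rightarrow> part" where
  "block_max u l m = Max (l ` {psum u (m - 1)<..psum u m})"

definition block_overpartitions :: "(nat \<Rightarrow> nat) \<Rightarrow> (nat \<Rightarrow> part) set" where
  "block_overpartitions u = {l \<in> seqs. \<forall>m\<ge>1. block_min u l m \<ge> block_max u l (m + 1)}"

definition block_partitions :: "(nat \<Rightarrow> nat) \<Rightarrow> (nat \<Rightarrow> part) set" where
  "block_partitions u = {l \<in> block_overpartitions u. \<forall>i\<ge>1. \<not> overlined (l i)}"

definition block_strict_overpartitions :: "(nat \<Rightarrow> nat) \<Rightarrow> (nat \<Rightarrow> part) set" where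
  "block_strict_overpartitions u = {l \<in> block_overpartitions u. \<forall>m\<ge>1.
     block_min u l m > Pln 0 \<longrightarrow>
       int (psize (block_min u l m)) - int (psize (block_max u l (m + 1))) > 0}"


section \<open>Eulerian polynomials\<close>

text \<open>
  The arguments $x_1,\ldots,x_n$ and $y_1,\ldots,y_n$ are passed as functions, of which only the
  values on \<open>{1..n}\<close> matter.
\<close>

definition eulerian_over :: "nat \<Rightarrow> (nat \<Rightarrow> 'a :: comm_ring_1) \<Rightarrow> (nat \<Rightarrow> 'a) \<Rightarrow> 'a" where
  "eulerian_over n x y =
     (y n + x n) * (\<Sum>\<sigma> | \<sigma> permutes {1..n}. \<Prod>i\<in>{1..<n}. (y i ^ of_bool (\<sigma> i > \<sigma> (i + 1)) + x i))"

definition eulerian :: "nat \<Rightarrow> (nat \<Rightarrow> 'a :: comm_ring_1) \<Rightarrow> 'a" where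
  "eulerian n y = (\<Sum>\<sigma> | \<sigma> permutes {1..n}. \<Prod>i\<in>{1..<n}. y i ^ of_bool (\<sigma> i > \<sigma> (i + 1)))"


section \<open>The two sides of the identities\<close>

text \<open>
  A finite or infinite increasing sequence $n_1 < n_2 < \cdots$ of positive integers, preceded by
  $n_0 = 0$, is a function to \<^typ>\<open>enat\<close> that takes the value \<open>\<infinity>\<close> beyond the last term if the
  sequence is finite. Accordingly, in the finite case with last term $n_r$, the factor (or summand)
  with index $r + 1$ ranges over all blocks after $n_r$ and the block $n_{r+1}$ does not exist.
\<close>

definition increasing_seq :: "(nat \<Rightarrow> enat) \<Rightarrow> bool" where
  "increasing_seq n \<longleftrightarrow>
     n 0 = 0 \<and> (\<forall>i. n i < n (Suc i) \<or> (n i = \<infinity> \<and> n (Suc i) = \<infinity>))"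

definition sseq :: "(nat \<Rightarrow> nat) \<Rightarrow> (nat \<Rightarrow> enat) \<Rightarrow> nat \<Rightarrow> nat" where
  "sseq u n i = (if \<exists>j\<ge>1. \<exists>m. n j = enat m \<and> i = psum u m then 1 else 0)"

definition gf_term :: "(nat \<Rightarrow> nat) \<Rightarrow> (nat \<Rightarrow> enat) \<Rightarrow> (nat \<Rightarrow> part) \<Rightarrow> indet mps" where
  "gf_term u n l = colour l * qvar ^ weight (sseq u n) l"

definition gap :: "(nat \<Rightarrow> enat) \<Rightarrow> nat \<Rightarrow> nat set" where
  "gap n i = {m. n (i - 1) < enat m \<and> enat m < n i}"

text \<open>
  Below, the suffix \<open>head\<close> refers to the fraction contributed by the one-element block $n_i$. Its
  colours are those of index $U_{n_i}$, the size of the columns that end in that block.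
\<close>

text \<open>Block \<open>m\<close>, with the colours multiplied by \<open>qvar ^ e\<close>.\<close>

definition xarg :: "(nat \<Rightarrow> nat) \<Rightarrow> nat \<Rightarrow> nat \<Rightarrow> nat \<Rightarrow> indet mps" where
  "xarg u m e j = col (Ovl (psum u (m - 1) + j)) * qvar ^ e"

definition yarg :: "(nat \<Rightarrow> nat) \<Rightarrow> nat \<Rightarrow> nat \<Rightarrow> nat \<Rightarrow> indet mps" where
  "yarg u m e j = col (Pln (psum u (m - 1) + j)) * qvar ^ e"

definition denom :: "nat \<Rightarrow> nat \<Rightarrow> nat \<Rightarrow> indet mps" where
  "denom a b e = (\<Prod>j\<in>{a..b}. 1 - col (Pln j) * qvar ^ e)"

definition over_block :: "(nat \<Rightarrow> nat) \<Rightarrow> nat \<Rightarrow> nat \<Rightarrow> indet mps" where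
  "over_block u m e =
     eulerian_over (u m) (xarg u m e) ((yarg u m e)(u m := 1))
       / denom (psum u (m - 1) + 1) (psum u m) e"

definition over_head :: "(nat \<Rightarrow> nat) \<Rightarrow> (nat \<Rightarrow> enat) \<Rightarrow> nat \<Rightarrow> indet mps" where
  "over_head u n i = (case n i of
       enat k \<Rightarrow> (1 + col (Ovl (psum u k)) * qvar ^ i) / (1 - col (Pln (psum u k)) * qvar ^ i)
     | \<infinity> \<Rightarrow> 1)"

definition plain_block :: "(nat \<Rightarrow> nat) \<Rightarrow> nat \<Rightarrow> nat \<Rightarrow> indet mps" where
  "plain_block u m e =
     eulerian (u m) (yarg u m e) / denom (psum u (m - 1) + 1) (psum u m) e"

definition plain_head :: "(nat \<Rightarrow> nat) \<Rightarrow> (nat \<Rightarrow> enat) \<Rightarrow> nat \<Rightarrow> indet mps" where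
  "plain_head u n i = (case n i of
       enat k \<Rightarrow> 1 / (1 - col (Pln (psum u k)) * qvar ^ i)
     | \<infinity> \<Rightarrow> 1)"

definition strict_block :: "(nat \<Rightarrow> nat) \<Rightarrow> nat \<Rightarrow> nat \<Rightarrow> indet mps" where
  "strict_block u m e =
     eulerian_over (u m) (xarg u m e) (yarg u m e) / denom (psum u (m - 1) + 1) (psum u m) e"

definition strict_last :: "(nat \<Rightarrow> nat) \<Rightarrow> nat \<Rightarrow> nat \<Rightarrow> indet mps" where
  "strict_last u k e =
     eulerian_over (u k) ((xarg u k e)(u k := 0)) ((yarg u k e)(u k := 1))
       / denom (psum u (k - 1) + 1) (psum u k - 1) e"

definition strict_head :: "(nat \<Rightarrow> nat) \<Rightarrow> (nat \<Rightarrow> enat) \<Rightarrow> nat \<Rightarrow> indet mps" where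
  "strict_head u n j = (case n j of
       enat k \<Rightarrow>
         (col (Pln (psum u k)) + col (Ovl (psum u k))) * qvar ^ j
           / (1 - col (Pln (psum u k)) * qvar ^ j)
     | \<infinity> \<Rightarrow> 1)"

definition over_factor :: "(nat \<Rightarrow> nat) \<Rightarrow> (nat \<Rightarrow> enat) \<Rightarrow> nat \<Rightarrow> indet mps" where
  "over_factor u n i =
     over_head u n i * (\<Prod>m. if m \<in> gap n i then over_block u m (i - 1) else 1)"

definition plain_factor :: "(nat \<Rightarrow> nat) \<Rightarrow> (nat \<Rightarrow> enat) \<Rightarrow> nat \<Rightarrow> indet mps" where
  "plain_factor u n i =
     plain_head u n i * (\<Prod>m. if m \<in> gap n i then plain_block u m (i - 1) else 1)"

text \<open>
  The summand with indices \<open>(i, k)\<close>, where \<open>k\<close> is the first block whose minimum is zero. It is only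
  used if $n_{i-1}$ is finite, so that the products are over finite sets.
\<close>

definition strict_term :: "(nat \<Rightarrow> nat) \<Rightarrow> (nat \<Rightarrow> enat) \<Rightarrow> nat \<Rightarrow> nat \<Rightarrow> indet mps" where
  "strict_term u n i k =
     strict_last u k (i - 1)
     * (\<Prod>m | n (i - 1) < enat m \<and> m < k. strict_block u m (i - 1))
     * (\<Prod>j\<in>{1..<i}. strict_head u n j * (\<Prod>m\<in>gap n j. strict_block u m (j - 1)))"

text \<open>The block $n_i$ itself can be the first block whose minimum is zero.\<close>

definition last_blocks :: "(nat \<Rightarrow> enat) \<Rightarrow> nat \<Rightarrow> nat set" where
  "last_blocks n i = {k. n (i - 1) < enat k \<and> enat k \<le> n i}"

end

theory Submission
  imports Defs "HOL-Combinatorics.Multiset_Permutations"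
begin

text \<open>
  A sequence \<open>\<lambda>\<close> is read through its columns \<open>A\<^sub>i = {j. \<lambda>\<^sub>j \<ge> Ovl i}\<close>, which form a decreasing
  chain of sets that are unions of initial blocks and a subset of the next one. The sequence is the
  chain together with a choice, at each strict descent, of whether the last element leaving the
  chain is over-lined. The colour and the power of \<open>q\<close> contributed by a column depend only on its
  size, because the blocks \<open>n\<^sub>i\<close> have one element; write \<open>y\<close> and \<open>x\<close> for the resulting weights of
  columns without and with over-lining. Splitting off the first column \<open>A\<close> gives
  \<open>(1 - y) G(A) = (y + x) \<Sum>G(B)\<close>, where \<open>G(A)\<close> is the generating function of the sequences with
  support \<open>A\<close> and \<open>B\<close> ranges over the proper successors of \<open>A\<close>. Within one block this recursion
  is solved, with \<open>w = (y + x) / (1 - y)\<close>, by the sums over linear arrangements of products of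
  \<open>w\<^sub>i\<close> (descent) and \<open>w\<^sub>i + 1\<close> (ascent), which become the Eulerian polynomials when denominators
  are cleared. Hence the generating functions of the sequences supported on the first blocks are
  products over the blocks, and the identities follow in the limit; for \<open>\<D>\<close> the sequences are
  sorted by the first block whose minimum is zero.
\<close>

section \<open>Monomials, generating functions and products of series\<close>

text \<open>Inside one block the columns are the earlier blocks together with a subset
  \<open>T\<close>, and their weights depend only on \<open>card T\<close>. What has to be summed is
  therefore a sum over strict chains of subsets. Such a chain, smallest set first and with each
  difference listed in increasing order, is a permutation with marked cuts: a descent must be cut,
  with weight w_i, and an ascent may be cut, with weight w_i + 1. The three identities differ only
  in how the full block enters the chain. It is optional for over-partitions and block partitions
  (factor w + 1), compulsory for the complete blocks of a strict sequence (factor w), and absent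
  from its first incomplete block (factor 1). Multiplied by 1 - y in the first two cases, these
  factors become 1 + x, y + x and 1, which explains the last arguments prescribed for the Eulerian
  polynomials. The grouping by n_i is a separate matter: products are computed over single blocks
  and regrouped afterwards, where the last group may be infinite.\<close>

lift_definition mon :: "'v multiset \<Rightarrow> 'v mps" is "\<lambda>M N. of_bool (N = M)" .

lemma mps_var_eq_mon: "mps_var v = mon {#v#}"
  by transfer auto

lemma mon_empty: "mon {#} = 1"
  by transfer auto

lemma mps_coeff_mon_mult:
  "mps_coeff (mon N * f) M = (if N \<subseteq># M then mps_coeff f (M - N) else 0)"
proof -
  have *: "N + (M - N) = M \<longleftrightarrow> N \<subseteq># M"
    by (metis mset_subset_eq_add_left subset_mset.add_diff_inverse)
  have "mps_coeff (mon N * f) M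
      = (\<Sum>p\<in>{(A, B). A + B = M}. if p = (N, M - N) then mps_coeff f (M - N) else 0)"
    unfolding times_mps.rep_eq mon.rep_eq by (rule sum.cong) auto
  also have "\<dots> = (if N \<subseteq># M then mps_coeff f (M - N) else 0)"
    using * by simp
  finally show ?thesis .
qed

lemma mon_add: "mon (M + N) = mon M * mon N"
proof (rule mps_eqI)
  fix K
  have "K = M + N \<longleftrightarrow> M \<subseteq># K \<and> K - M = N"
    using subset_mset.add_diff_inverse[of M K] by auto
  then show "mps_coeff (mon (M + N)) K = mps_coeff (mon M * mon N) K"
    by (simp add: mps_coeff_mon_mult mon.rep_eq)
qed

lemma mon_sum: "mon (\<Sum>i\<in>I. f i) = (\<Prod>i\<in>I. mon (f i))"
  by (induction I rule: infinite_finite_induct) (auto simp: mon_empty mon_add)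

lemma mon_replicate: "mon (replicate_mset k v) = mps_var v ^ k"
proof (induction k)
  case (Suc k)
  have "mon (replicate_mset (Suc k) v) = mon ({#v#} + replicate_mset k v)" by simp
  then show ?case using Suc by (simp only: mon_add mps_var_eq_mon power_Suc)
qed (simp add: mon_empty)

lemma const_coeff_mult: "mps_coeff (f * g) {#} = mps_coeff f {#} * mps_coeff g {#}"
proof -
  have "{(A, B). A + B = ({#} :: 'a multiset)} = {({#}, {#})}" by auto
  then show ?thesis by (simp add: times_mps.rep_eq)
qed

lemma const_coeff_prod: "mps_coeff (\<Prod>i\<in>I. f i) {#} = (\<Prod>i\<in>I. mps_coeff (f i) {#})"
  by (induction I rule: infinite_finite_induct) (auto simp: const_coeff_mult one_mps.rep_eq)

text \<open>A coefficient of \<open>c * f x\<close> at \<open>M\<close> involves \<open>f x\<close>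
  only at the finitely many submultisets of \<open>M\<close>.\<close>

lemma tendsto_mps_mult_left:
  fixes f :: "'a \<Rightarrow> 'v mps"
  assumes "(f \<longlongrightarrow> l) F"
  shows "((\<lambda>x. c * f x) \<longlongrightarrow> c * l) F"
  unfolding tendsto_mps_iff
proof
  fix M
  have "\<forall>\<^sub>F x in F. \<forall>B\<in>{B. B \<subseteq># M}. mps_coeff (f x) B = mps_coeff l B"
    using assms finite_submultisets[of M] unfolding tendsto_mps_iff
    by (subst eventually_ball_finite_distrib) auto
  then show "\<forall>\<^sub>F x in F. mps_coeff (c * f x) M = mps_coeff (c * l) M"
    by eventually_elim (auto simp: times_mps.rep_eq intro!: sum.cong)
qed

text \<open>The constant coefficient 1 survives in the limit, so \<open>p\<close> is nonzero and the
  product converges without dropping initial factors. Since no factor vanishes, the zero-factor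
  clause of \<open>has_prod\<close> cannot apply and the value is unique.\<close>

lemma mps_prodinf:
  fixes f :: "nat \<Rightarrow> 'v mps"
  assumes const: "\<And>i. mps_coeff (f i) {#} = 1"
    and lim: "(\<lambda>N. \<Prod>i\<le>N. f i) \<longlonglongrightarrow> p"
  shows "convergent_prod f" and "prodinf f = p"
proof -
  have "\<forall>\<^sub>F N in sequentially. mps_coeff (\<Prod>i\<le>N. f i) {#} = mps_coeff p {#}"
    using lim by (simp add: tendsto_mps_iff)
  then have p: "mps_coeff p {#} = 1"
    by (simp add: const_coeff_prod const)
  then have "p \<noteq> 0" by (auto simp: zero_mps.rep_eq)
  then have raw: "raw_has_prod f 0 p"
    using lim by (simp add: raw_has_prod_def)
  then show "convergent_prod f"
    unfolding convergent_prod_def by blast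
  have nz: "f i \<noteq> 0" for i using const[of i] by (auto simp: zero_mps.rep_eq)
  have "f has_prod q \<longleftrightarrow> q = p" for q
    using raw nz LIMSEQ_unique[OF lim] by (auto simp: has_prod_def raw_has_prod_def)
  then show "prodinf f = p"
    unfolding prodinf_def by (intro the_equality) auto
qed

section \<open>Generating functions of sets of weighted objects\<close>

definition fin_fibres :: "('a \<Rightarrow> 'v multiset) \<Rightarrow> 'a set \<Rightarrow> bool" where
  "fin_fibres \<mu> S \<longleftrightarrow> (\<forall>M. finite {x \<in> S. \<mu> x = M})"

text \<open>As \<open>card\<close> is 0 on infinite sets, the coefficients are genuine counts only
  under \<open>fin_fibres\<close>.\<close>

lift_definition mgf :: "('a \<Rightarrow> 'v multiset) \<Rightarrow> 'a set \<Rightarrow> 'v mps" is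
  "\<lambda>\<mu> S M. int (card {x \<in> S. \<mu> x = M})" .

lemma fin_fibres_subset:
  assumes "fin_fibres \<mu> S" "T \<subseteq> S"
  shows "fin_fibres \<mu> T"
  unfolding fin_fibres_def
proof
  fix M
  show "finite {x \<in> T. \<mu> x = M}"
    by (rule finite_subset[of _ "{x \<in> S. \<mu> x = M}"]) (use assms in \<open>auto simp: fin_fibres_def\<close>)
qed

text \<open>Each coefficient counts one finite fibre, and disjointness embeds the set
  \<open>J\<close> of contributing indices into that fibre. The finite partial sums are thus
  constant as soon as they include \<open>J\<close>.\<close>

lemma mgf_UN_has_sum:
  assumes fin: "fin_fibres \<mu> (\<Union>i\<in>I. S i)" and disj: "disjoint_family_on S I"
  shows "((\<lambda>i. mgf \<mu> (S i)) has_sum mgf \<mu> (\<Union>i\<in>I. S i)) I"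
  unfolding has_sum_def tendsto_mps_iff
proof
  fix M
  let ?X = "{x \<in> (\<Union>i\<in>I. S i). \<mu> x = M}"
  define J where "J = {i \<in> I. \<exists>x\<in>S i. \<mu> x = M}"
  have finX: "finite ?X" using fin by (simp add: fin_fibres_def)
  have "\<forall>i\<in>J. \<exists>x. x \<in> S i \<and> \<mu> x = M" by (auto simp: J_def)
  then obtain w where w: "\<And>i. i \<in> J \<Longrightarrow> w i \<in> S i \<and> \<mu> (w i) = M" by metis
  have "J \<subseteq> I" by (auto simp: J_def)
  have "inj_on w J"
  proof (rule inj_onI, rule ccontr)
    fix i j
    assume ij: "i \<in> J" "j \<in> J" "w i = w j" "i \<noteq> j"
    then have "S i \<inter> S j = {}" using disj \<open>J \<subseteq> I\<close> by (auto simp: disjoint_family_on_def)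
    then show False using w[of i] w[of j] ij by auto
  qed
  moreover have "w ` J \<subseteq> ?X" using w \<open>J \<subseteq> I\<close> by blast
  ultimately have finJ: "finite J" using finX inj_on_finite by blast
  have "mps_coeff (\<Sum>i\<in>K. mgf \<mu> (S i)) M = mps_coeff (mgf \<mu> (\<Union>i\<in>I. S i)) M"
    if K: "finite K" "J \<subseteq> K" "K \<subseteq> I" for K
  proof -
    have "?X = (\<Union>i\<in>K. {x \<in> S i. \<mu> x = M})"
      using K(2,3) unfolding J_def by blast
    moreover have "finite {x \<in> S i. \<mu> x = M}" if "i \<in> K" for i
    proof (rule finite_subset[OF _ finX])
      show "{x \<in> S i. \<mu> x = M} \<subseteq> ?X" using that K(3) by blast
    qed
    moreover have "{x \<in> S i. \<mu> x = M} \<inter> {x \<in> S j. \<mu> x = M} = {}"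
      if "i \<in> K" "j \<in> K" "i \<noteq> j" for i j
    proof -
      have "S i \<inter> S j = {}" using disj K(3) that by (auto simp: disjoint_family_on_def)
      then show ?thesis by blast
    qed
    ultimately have "card ?X = (\<Sum>i\<in>K. card {x \<in> S i. \<mu> x = M})"
      using card_UN_disjoint[OF K(1), of "\<lambda>i. {x \<in> S i. \<mu> x = M}"] by simp
    then show ?thesis by (simp add: mps_coeff_sum mgf.rep_eq)
  qed
  then show "\<forall>\<^sub>F K in finite_subsets_at_top I.
      mps_coeff (\<Sum>i\<in>K. mgf \<mu> (S i)) M = mps_coeff (mgf \<mu> (\<Union>i\<in>I. S i)) M"
    unfolding eventually_finite_subsets_at_top by (intro exI[of _ J]) (use finJ in \<open>auto simp: J_def\<close>)
qed

lemma mgf_UN: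
  assumes "finite I" "fin_fibres \<mu> (\<Union>i\<in>I. S i)" "disjoint_family_on S I"
  shows "mgf \<mu> (\<Union>i\<in>I. S i) = (\<Sum>i\<in>I. mgf \<mu> (S i))"
  using infsumI[OF mgf_UN_has_sum[OF assms(2,3)]] assms(1) by simp

lemma mgf_Un:
  assumes "fin_fibres \<mu> (S \<union> T)" "S \<inter> T = {}"
  shows "mgf \<mu> (S \<union> T) = mgf \<mu> S + mgf \<mu> T"
proof -
  let ?F = "\<lambda>b. if b then S else T"
  have "(\<Union>b\<in>{True, False}. ?F b) = S \<union> T" by auto
  moreover have "disjoint_family_on ?F {True, False}"
    using assms(2) by (auto simp: disjoint_family_on_def)
  ultimately show ?thesis
    using mgf_UN[of "{True, False}" \<mu> ?F] assms(1) by simp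
qed

lemma mgf_singleton: "mgf \<mu> {x} = mon (\<mu> x)"
proof -
  have "{y. y = x \<and> \<mu> y = M} = (if \<mu> x = M then {x} else {})" for M by auto
  then show ?thesis by (auto simp: mgf.rep_eq mon.rep_eq intro!: mps_eqI)
qed

lemma mgf_empty: "mgf \<mu> {} = 0"
  by transfer auto

lemma mgf_has_sum:
  assumes "fin_fibres \<mu> S"
  shows "((\<lambda>x. mon (\<mu> x)) has_sum mgf \<mu> S) S"
  using mgf_UN_has_sum[of \<mu> "\<lambda>x. {x}" S] assms by (simp add: mgf_singleton disjoint_family_on_def)

lemma mgf_image:
  assumes "inj_on f S" "\<And>x. x \<in> S \<Longrightarrow> \<mu> (f x) = N + \<nu> x"
  shows "mgf \<mu> (f ` S) = mon N * mgf \<nu> S"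
proof (rule mps_eqI)
  fix M
  show "mps_coeff (mgf \<mu> (f ` S)) M = mps_coeff (mon N * mgf \<nu> S) M"
  proof (cases "N \<subseteq># M")
    case True
    have "{y \<in> f ` S. \<mu> y = M} = f ` {x \<in> S. \<nu> x = M - N}"
      using assms(2) True by (auto simp: subset_mset.add_diff_inverse)
    moreover have "inj_on f {x \<in> S. \<nu> x = M - N}" using assms(1) by (auto simp: inj_on_def)
    ultimately show ?thesis using True by (simp add: mgf.rep_eq mps_coeff_mon_mult card_image)
  next
    case False
    have *: "{y \<in> f ` S. \<mu> y = M} = {}" using assms(2) False by auto
    show ?thesis using False unfolding mgf.rep_eq mps_coeff_mon_mult * by simp
  qed
qed

lemma mgf_tendsto:
  assumes fin: "fin_fibres \<mu> S" and sub: "\<And>k. T k \<subseteq> S"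
    and ev: "\<And>x. x \<in> S \<Longrightarrow> \<forall>\<^sub>F k in F. x \<in> T k"
  shows "((\<lambda>k. mgf \<mu> (T k)) \<longlongrightarrow> mgf \<mu> S) F"
  unfolding tendsto_mps_iff
proof
  fix M
  have "\<forall>\<^sub>F k in F. \<forall>x\<in>{x \<in> S. \<mu> x = M}. x \<in> T k"
    using fin ev unfolding fin_fibres_def by (subst eventually_ball_finite_distrib) auto
  then show "\<forall>\<^sub>F k in F. mps_coeff (mgf \<mu> (T k)) M = mps_coeff (mgf \<mu> S) M"
  proof eventually_elim
    case (elim k)
    then have "{x \<in> T k. \<mu> x = M} = {x \<in> S. \<mu> x = M}" using sub by auto
    then show ?case by (simp add: mgf.rep_eq)
  qed
qed

section \<open>Eulerian sums\<close>

text \<open>Expanding the product chooses at each position to cut (weight \<open>w i\<close>) or, at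
  ascents only, not to cut: the terms are the ways to cut the list into increasing runs. The length
  \<open>k\<close> is a parameter so that prefixes can be treated on the full list.\<close>

definition asc_prod :: "(nat \<Rightarrow> 'a :: comm_ring_1) \<Rightarrow> nat \<Rightarrow> 'b :: linorder list \<Rightarrow> 'a" where
  "asc_prod w k xs = (\<Prod>i\<in>{1..<k}. w i + of_bool (xs ! (i - 1) < xs ! i))"

lemma asc_prod_append:
  assumes "k \<le> length xs"
  shows "asc_prod w k (xs @ ys) = asc_prod w k xs"
  unfolding asc_prod_def using assms by (intro prod.cong refl) (auto simp: nth_append)

text \<open>The terms are sorted by the position \<open>s\<close> of the last cut, after which the
  list must be increasing; the first summand is the case without cuts.\<close>

lemma asc_prod_expand:
  fixes w :: "nat \<Rightarrow> 'a :: comm_ring_1" and xs :: "'b :: linorder list"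
  assumes "xs \<noteq> []"
  shows "asc_prod w (length xs) xs = of_bool (sorted_wrt (<) xs)
    + (\<Sum>s\<in>{1..<length xs}. asc_prod w s xs * w s * of_bool (sorted_wrt (<) (drop s xs)))"
  using assms
proof (induction xs rule: rev_nonempty_induct)
  case (single x)
  show ?case by (simp add: asc_prod_def)
next
  case (snoc b xs)
  let ?l = "length xs" and ?c = "of_bool (last xs < b) :: 'a"
  \<comment> \<open>All nonempty suffixes of \<open>xs\<close> share their last entry, so appending
    \<open>b\<close> multiplies each of their indicators by the same \<open>?c\<close>.\<close>
  have sorted_snoc: "of_bool (sorted_wrt (<) (zs @ [b])) = of_bool (sorted_wrt (<) zs) * ?c"
    if "zs \<noteq> []" "last zs = last xs" for zs
  proof -
    have "sorted_wrt (<) (zs @ [b]) \<longleftrightarrow> sorted_wrt (<) zs \<and> last zs < b"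
      using that(1) by (induction zs rule: rev_nonempty_induct) (auto simp: sorted_wrt_append)
    then show ?thesis using that(2) by simp
  qed
  have l: "?l \<ge> 1" using snoc.hyps by (cases xs) auto
  have "asc_prod w (length (xs @ [b])) (xs @ [b]) = asc_prod w ?l xs * (w ?l + ?c)"
  proof -
    have "{1..<length (xs @ [b])} = insert ?l {1..<?l}" using l by auto
    then have "asc_prod w (length (xs @ [b])) (xs @ [b]) = asc_prod w ?l (xs @ [b]) * (w ?l + ?c)"
      using snoc.hyps l by (simp add: asc_prod_def nth_append last_conv_nth mult.commute)
    then show ?thesis by (simp add: asc_prod_append)
  qed
  also have "\<dots> = asc_prod w ?l xs * w ?l + (of_bool (sorted_wrt (<) xs) + (\<Sum>s\<in>{1..<?l}.
      asc_prod w s xs * w s * of_bool (sorted_wrt (<) (drop s xs)))) * ?c"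
    by (simp only: distrib_left snoc.IH[symmetric])
  also have "\<dots> = of_bool (sorted_wrt (<) xs) * ?c + ((\<Sum>s\<in>{1..<?l}.
      asc_prod w s xs * w s * (of_bool (sorted_wrt (<) (drop s xs)) * ?c)) + asc_prod w ?l xs * w ?l)"
    by (simp only: distrib_right sum_distrib_right mult.assoc add_ac)
  also have "of_bool (sorted_wrt (<) xs) * ?c = of_bool (sorted_wrt (<) (xs @ [b]))"
    using sorted_snoc[of xs] snoc.hyps by simp
  also have "(\<Sum>s\<in>{1..<?l}. asc_prod w s xs * w s * (of_bool (sorted_wrt (<) (drop s xs)) * ?c))
      = (\<Sum>s\<in>{1..<?l}. asc_prod w s (xs @ [b]) * w s
          * of_bool (sorted_wrt (<) (drop s (xs @ [b]))))"
  proof (rule sum.cong)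
    fix s
    assume "s \<in> {1..<?l}"
    then show "asc_prod w s xs * w s * (of_bool (sorted_wrt (<) (drop s xs)) * ?c)
      = asc_prod w s (xs @ [b]) * w s * of_bool (sorted_wrt (<) (drop s (xs @ [b])))"
      using sorted_snoc[of "drop s xs"] by (simp add: asc_prod_append)
  qed simp
  also have "\<dots> + asc_prod w ?l xs * w ?l = (\<Sum>s\<in>{1..<length (xs @ [b])}.
      asc_prod w s (xs @ [b]) * w s * of_bool (sorted_wrt (<) (drop s (xs @ [b]))))"
  proof -
    let ?t = "\<lambda>s. asc_prod w s (xs @ [b]) * w s * of_bool (sorted_wrt (<) (drop s (xs @ [b])))"
    have "{1..<length (xs @ [b])} = insert ?l {1..<?l}" using l by auto
    then have "sum ?t {1..<length (xs @ [b])} = sum ?t {1..<?l} + ?t ?l"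
      by (simp only:) (subst sum.insert, auto simp: add.commute simp del: drop_append)
    moreover have "?t ?l = asc_prod w ?l xs * w ?l" by (simp add: asc_prod_append)
    ultimately show ?thesis by (simp only:)
  qed
  finally show ?case .
qed

definition asc_sum :: "(nat \<Rightarrow> 'a :: comm_ring_1) \<Rightarrow> 'b :: linorder set \<Rightarrow> 'a" where
  "asc_sum w T = (\<Sum>xs\<in>permutations_of_set T. asc_prod w (card T) xs)"

text \<open>The entries before the last cut form an arbitrary permutation of some \<open>S\<close>,
  and those after it are \<open>T - S\<close> in increasing order. Hence a permutation with a marked
  last cut is the same as a pair of \<open>S\<close> and a permutation of \<open>S\<close>.\<close>

lemma asc_sum_rec:
  fixes w :: "nat \<Rightarrow> 'a :: comm_ring_1" and T :: "'b :: linorder set"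
  assumes "finite T" "T \<noteq> {}"
  shows "asc_sum w T = 1 + (\<Sum>S\<in>{S. S \<noteq> {} \<and> S \<subset> T}. w (card S) * asc_sum w S)"
proof -
  let ?P = "permutations_of_set T" and ?n = "card T"
  have len: "length xs = ?n" if "xs \<in> ?P" for xs
    using that by (rule length_finite_permutations_of_set)
  have fin: "finite ?P" by simp
  have sorted_iff: "xs = sorted_list_of_set (set xs)" if "sorted_wrt (<) xs" for xs :: "'b list"
    using that by (metis sorted_list_of_set.idem_if_sorted_distinct strict_sorted_iff)
  have sorted_perms: "{xs \<in> ?P. sorted_wrt (<) xs} = {sorted_list_of_set T}"
    using assms(1) sorted_iff by (auto simp: permutations_of_set_def)
  have "asc_sum w T = (\<Sum>xs\<in>?P. of_bool (sorted_wrt (<) xs) + (\<Sum>s\<in>{1..<?n}.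
      asc_prod w s xs * w s * of_bool (sorted_wrt (<) (drop s xs))))"
    unfolding asc_sum_def
  proof (rule sum.cong)
    fix xs
    assume xs: "xs \<in> ?P"
    then have "xs \<noteq> []" using assms(2) by (auto simp: permutations_of_set_def)
    from asc_prod_expand[OF this, of w] show "asc_prod w ?n xs = of_bool (sorted_wrt (<) xs)
      + (\<Sum>s\<in>{1..<?n}. asc_prod w s xs * w s * of_bool (sorted_wrt (<) (drop s xs)))"
      by (simp only: len[OF xs])
  qed simp
  also have "\<dots> = (\<Sum>xs\<in>?P. of_bool (sorted_wrt (<) xs)) + (\<Sum>s\<in>{1..<?n}. \<Sum>xs\<in>?P.
      asc_prod w s xs * w s * of_bool (sorted_wrt (<) (drop s xs)))"
    by (simp only: sum.distrib) (subst sum.swap, rule refl)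
  also have "(\<Sum>xs\<in>?P. of_bool (sorted_wrt (<) xs)) = (1 :: 'a)"
    using fin by (simp add: sum.If_cases of_bool_def Int_def sorted_perms)
  also have "(\<Sum>s\<in>{1..<?n}. \<Sum>xs\<in>?P. asc_prod w s xs * w s * of_bool (sorted_wrt (<) (drop s xs)))
      = (\<Sum>s\<in>{1..<?n}. \<Sum>xs\<in>{xs \<in> ?P. sorted_wrt (<) (drop s xs)}. asc_prod w s xs * w s)"
    by (intro sum.cong refl sum.mono_neutral_cong_right) auto
  also have "\<dots> = (\<Sum>(s, xs)\<in>Sigma {1..<?n} (\<lambda>s. {xs \<in> ?P. sorted_wrt (<) (drop s xs)}).
      asc_prod w s xs * w s)"
    by (subst sum.Sigma) auto
  also have "\<dots> = (\<Sum>(S, ys)\<in>Sigma {S. S \<noteq> {} \<and> S \<subset> T} permutations_of_set.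
      w (card S) * asc_prod w (card S) ys)"
  proof (rule sum.reindex_bij_witness[where
        j = "\<lambda>(s, xs). (set (take s xs), take s xs)" and
        i = "\<lambda>(S, ys). (card S, ys @ sorted_list_of_set (T - S))"])
    fix p
    assume "p \<in> Sigma {1..<?n} (\<lambda>s. {xs \<in> ?P. sorted_wrt (<) (drop s xs)})"
    then obtain s xs where p: "p = (s, xs)" "1 \<le> s" "s < ?n" "xs \<in> ?P" "sorted_wrt (<) (drop s xs)"
      by auto
    have xs: "distinct xs" "set xs = T" "length xs = ?n"
      using p len by (auto simp: permutations_of_set_def)
    have card: "card (set (take s xs)) = s"
      using xs p by (simp add: distinct_card)
    have "T = set (take s xs) \<union> set (drop s xs)"
      unfolding xs(2)[symmetric] by (simp flip: set_append)
    moreover have "set (take s xs) \<inter> set (drop s xs) = {}"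
      using xs(1) by (rule set_take_disj_set_drop_if_distinct) simp
    ultimately have "T - set (take s xs) = set (drop s xs)" by blast
    then have rest: "sorted_list_of_set (T - set (take s xs)) = drop s xs"
      using sorted_iff[OF p(5)] by simp
    show "(case case p of (s, xs) \<Rightarrow> (set (take s xs), take s xs) of
        (S, ys) \<Rightarrow> (card S, ys @ sorted_list_of_set (T - S))) = p"
      by (simp add: p(1) card rest)
    have "set (take s xs) \<noteq> {}" using card p(2) by auto
    moreover have "set (take s xs) \<subset> T"
      using card p(3) xs(2) by (metis less_irrefl psubsetI set_take_subset)
    ultimately show "(case p of (s, xs) \<Rightarrow> (set (take s xs), take s xs))
        \<in> Sigma {S. S \<noteq> {} \<and> S \<subset> T} permutations_of_set"
      using xs(1) by (simp add: p(1) permutations_of_set_def)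
    have "asc_prod w s (take s xs) = asc_prod w s xs"
      using asc_prod_append[of s "take s xs" w "drop s xs"] xs(3) p(3) by simp
    then show "(case case p of (s, xs) \<Rightarrow> (set (take s xs), take s xs) of
        (S, ys) \<Rightarrow> w (card S) * asc_prod w (card S) ys) = (case p of (s, xs) \<Rightarrow> asc_prod w s xs * w s)"
      by (simp add: p(1) card mult.commute)
  next
    fix p
    assume "p \<in> Sigma {S. S \<noteq> {} \<and> S \<subset> T} permutations_of_set"
    then obtain S ys where "p = (S, ys)" "S \<noteq> {}" "S \<subset> T" "ys \<in> permutations_of_set S"
      by blast
    then have p: "p = (S, ys)" "S \<noteq> {}" "S \<subset> T" "set ys = S" "distinct ys"
      by (simp_all add: permutations_of_set_def)
    have finS: "finite S" using p(3) assms(1) finite_subset by blast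
    have len_ys: "length ys = card S" using p(4,5) distinct_card by fastforce
    show "(case case p of (S, ys) \<Rightarrow> (card S, ys @ sorted_list_of_set (T - S)) of
        (s, xs) \<Rightarrow> (set (take s xs), take s xs)) = p"
      by (simp add: p len_ys flip: p(4))
    have "card S < ?n" using p(3) assms(1) psubset_card_mono by blast
    moreover have "card S \<ge> 1" using finS p(2) by (simp add: Suc_le_eq card_gt_0_iff)
    moreover have "ys @ sorted_list_of_set (T - S) \<in> ?P"
      using p(3-5) assms(1) by (auto simp: permutations_of_set_def)
    ultimately show "(case p of (S, ys) \<Rightarrow> (card S, ys @ sorted_list_of_set (T - S)))
        \<in> Sigma {1..<?n} (\<lambda>s. {xs \<in> ?P. sorted_wrt (<) (drop s xs)})"
      by (simp add: p(1) len_ys)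
  qed
  also have "\<dots> = (\<Sum>S\<in>{S. S \<noteq> {} \<and> S \<subset> T}. w (card S) * asc_sum w S)"
    using assms(1) by (subst sum.Sigma[symmetric]) 
      (auto simp: asc_sum_def sum_distrib_left intro: finite_subset[of _ "Pow T"])
  finally show ?thesis .
qed

text \<open>Permutations are passed to their one-line notation; the shift by \<open>a\<close> does
  not affect comparisons. Surjectivity follows from injectivity by counting.\<close>

lemma asc_sum_interval:
  "asc_sum w {a + 1..a + k}
    = (\<Sum>\<sigma> | \<sigma> permutes {1..k}. \<Prod>i\<in>{1..<k}. w i + of_bool (\<sigma> i < \<sigma> (i + 1)))"
proof -
  define f where "f \<sigma> = map (\<lambda>i. a + \<sigma> i) [1..<Suc k]" for \<sigma> :: "nat \<Rightarrow> nat"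
  let ?S = "{\<sigma>. \<sigma> permutes {1..k}}" and ?P = "permutations_of_set {a + 1..a + k}"
  have inj: "inj_on f ?S"
  proof (rule inj_onI, rule ext)
    fix \<sigma> \<tau> i
    assume *: "\<sigma> \<in> ?S" "\<tau> \<in> ?S" "f \<sigma> = f \<tau>"
    show "\<sigma> i = \<tau> i"
    proof (cases "i \<in> {1..k}")
      case True
      then have "i - 1 < k" "Suc (i - 1) = i" by auto
      moreover have "f \<sigma> ! (i - 1) = f \<tau> ! (i - 1)" using *(3) by simp
      ultimately show ?thesis by (simp add: f_def del: upt_Suc)
    next
      case False
      then show ?thesis using * permutes_not_in by (metis mem_Collect_eq)
    qed
  qed
  have "f \<sigma> \<in> ?P" if "\<sigma> permutes {1..k}" for \<sigma>
  proof -
    have "set (f \<sigma>) = (+) a ` \<sigma> ` {1..k}"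
      unfolding f_def set_map set_upt image_image atLeastLessThanSuc_atLeastAtMost ..
    also have "\<sigma> ` {1..k} = {1..k}" using that by (rule permutes_image)
    finally have "set (f \<sigma>) = {a + 1..a + k}" by simp
    moreover have "distinct (f \<sigma>)"
      using permutes_inj[OF that] by (auto simp: f_def distinct_map inj_on_def inj_def simp del: upt_Suc)
    ultimately show ?thesis by (simp add: permutations_of_set_def)
  qed
  then have "f ` ?S \<subseteq> ?P" by blast
  moreover have "card (f ` ?S) = card ?P"
    using inj by (simp add: card_image card_permutations[of _ k])
  ultimately have im: "f ` ?S = ?P" by (intro card_subset_eq) auto
  have "asc_sum w {a + 1..a + k} = (\<Sum>\<sigma>\<in>?S. asc_prod w k (f \<sigma>))"
    unfolding asc_sum_def im[symmetric] by (subst sum.reindex[OF inj]) simp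
  also have "\<dots> = (\<Sum>\<sigma>\<in>?S. \<Prod>i\<in>{1..<k}. w i + of_bool (\<sigma> i < \<sigma> (i + 1)))"
    unfolding asc_prod_def by (intro sum.cong prod.cong refl) (auto simp: f_def simp del: upt_Suc)
  finally show ?thesis .
qed

text \<open>With d = 1 - y the two hypotheses are the cleared forms of w at a descent and of w + 1
  at an ascent. Consecutive values of a permutation differ, so there is no third case.\<close>

lemma asc_sum_eulerian:
  assumes "\<And>i. i \<in> {1..<k} \<Longrightarrow> d i * w i = y i + x i"
    and "\<And>i. i \<in> {1..<k} \<Longrightarrow> d i * (w i + 1) = 1 + x i"
  shows "(\<Prod>i\<in>{1..<k}. d i) * asc_sum w {a + 1..a + k}
    = (\<Sum>\<sigma> | \<sigma> permutes {1..k}. \<Prod>i\<in>{1..<k}. y i ^ of_bool (\<sigma> i > \<sigma> (i + 1)) + x i)"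
  unfolding asc_sum_interval sum_distrib_left prod.distrib[symmetric]
proof (intro sum.cong prod.cong refl)
  fix \<sigma> i
  assume "\<sigma> \<in> {\<sigma>. \<sigma> permutes {1..k}}" and i: "i \<in> {1..<k}"
  then have "\<sigma> i \<noteq> \<sigma> (i + 1)" by (metis mem_Collect_eq n_not_Suc_n permutes_inj injD Suc_eq_plus1)
  then have "\<sigma> i < \<sigma> (i + 1) \<longleftrightarrow> \<not> \<sigma> (i + 1) < \<sigma> i" by auto
  then show "d i * (w i + of_bool (\<sigma> i < \<sigma> (i + 1))) = y i ^ of_bool (\<sigma> i > \<sigma> (i + 1)) + x i"
    using assms[OF i] by auto
qed

section \<open>Block over-partitions as admissible sequences\<close>

lemma psize_mono: "p \<le> r \<Longrightarrow> psize p \<le> psize r"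
  by (auto simp: less_eq_part_def)

lemma Ovl_le_iff: "Ovl i \<le> p \<longleftrightarrow> i \<le> psize p"
  by (cases p) (auto simp: less_eq_part_def)

lemma Pln_0_less_iff: "p \<noteq> Ovl 0 \<Longrightarrow> Pln 0 < p \<longleftrightarrow> 0 < psize p"
  by (cases p) (auto simp: less_eq_part_def less_part_def)

lemma psize_eq_0_iff: "p \<noteq> Ovl 0 \<Longrightarrow> psize p = 0 \<longleftrightarrow> p = Pln 0"
  by (cases p) auto

definition supp :: "(nat \<Rightarrow> part) \<Rightarrow> nat set" where
  "supp l = {i. l i \<noteq> Pln 0}"

locale blocks =
  fixes u :: "nat \<Rightarrow> nat" and n :: "nat \<Rightarrow> enat"
  assumes u_pos: "\<And>m. m \<ge> 1 \<Longrightarrow> u m \<ge> 1"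
    and n_incr: "increasing_seq n"
    and u_n: "\<And>i m. i \<ge> 1 \<Longrightarrow> n i = enat m \<Longrightarrow> u m = 1"
begin

lemma psum_0 [simp]: "psum u 0 = 0"
  by (simp add: psum_def)

lemma psum_Suc [simp]: "psum u (Suc m) = psum u m + u (Suc m)"
  by (simp add: psum_def)

lemma u_Suc_pos [simp]: "0 < u (Suc m)"
  using u_pos[of "Suc m"] by simp

lemma psum_strict_mono: "strict_mono (psum u)"
  by (rule strict_mono_Suc_iff[THEN iffD2]) (use u_pos in \<open>auto simp: Suc_le_eq\<close>)

lemma psum_less_iff [simp]: "psum u a < psum u b \<longleftrightarrow> a < b"
  by (rule strict_mono_less[OF psum_strict_mono])

lemma psum_le_iff [simp]: "psum u a \<le> psum u b \<longleftrightarrow> a \<le> b"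
  by (rule strict_mono_less_eq[OF psum_strict_mono])

lemma psum_ge: "m \<le> psum u m"
  by (rule strict_mono_imp_increasing[OF psum_strict_mono])

lemma ex_block:
  assumes "i \<ge> 1"
  obtains m where "m \<ge> 1" "i \<in> {psum u (m - 1)<..psum u m}"
proof -
  define m where "m = (LEAST m. i \<le> psum u m)"
  have le: "i \<le> psum u m" unfolding m_def by (rule LeastI[of _ i]) (rule psum_ge)
  then have "m \<ge> 1" using assms by (cases m) auto
  moreover have "\<not> i \<le> psum u (m - 1)"
    using not_less_Least[of "m - 1" "\<lambda>m. i \<le> psum u m"] \<open>m \<ge> 1\<close> by (simp add: m_def)
  ultimately show ?thesis using le that by auto
qed

definition prec :: "nat \<Rightarrow> nat \<Rightarrow> bool" where
  "prec i j \<longleftrightarrow> 1 \<le> i \<and> (\<exists>m. i \<le> psum u m \<and> psum u m < j)"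

lemma prec_less: "prec i j \<Longrightarrow> i < j"
  by (auto simp: prec_def)

lemma prec_blocks:
  assumes "i \<in> {psum u (a - 1)<..psum u a}" "j \<in> {psum u (b - 1)<..psum u b}" "a < b" "a \<ge> 1"
  shows "prec i j"
proof -
  have "a \<le> b - 1" using assms(3) by simp
  then have "psum u a \<le> psum u (b - 1)" by (simp only: psum_le_iff)
  also have "psum u (b - 1) < j" using assms(2) by simp
  finally have "psum u a < j" .
  then show ?thesis using assms(1) unfolding prec_def by (intro conjI exI[of _ a]) auto
qed

lemma prec_cases:
  assumes "prec i j"
  obtains a b where "1 \<le> a" "a < b" "i \<in> {psum u (a - 1)<..psum u a}"
    "j \<in> {psum u (b - 1)<..psum u b}"
proof -
  obtain m where m: "1 \<le> i" "i \<le> psum u m" "psum u m < j" using assms by (auto simp: prec_def)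
  obtain a where a: "a \<ge> 1" "i \<in> {psum u (a - 1)<..psum u a}" using ex_block m(1) by blast
  have "j \<ge> 1" using m(3) by simp
  then obtain b where b: "b \<ge> 1" "j \<in> {psum u (b - 1)<..psum u b}" using ex_block by blast
  have "psum u (a - 1) < psum u m" using a m by (meson greaterThanAtMost_iff order_less_le_trans)
  moreover have "psum u m < psum u b" using b m by (meson greaterThanAtMost_iff order_less_le_trans)
  ultimately have "a < b" by simp
  then show ?thesis using that a b by blast
qed

text \<open>
  \<open>D\<close> selects the sequences in $\overline{\mathcal D}(U)$, and \<open>V\<close> permits over-lined parts. The block
  conditions can be expressed by sizes alone, since only the last part of a given size can be
  over-lined.
\<close>

definition admissible :: "bool \<Rightarrow> bool \<Rightarrow> (nat \<Rightarrow> part) set" where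
  "admissible D V = {l. l 0 = Pln 0 \<and> (\<forall>i. l i \<noteq> Ovl 0) \<and> finite (supp l)
     \<and> (\<forall>i j. overlined (l i) \<and> psize (l j) = psize (l i) \<longrightarrow> j \<le> i)
     \<and> (\<forall>i j. prec i j \<longrightarrow> psize (l j) \<le> psize (l i)
           \<and> (D \<and> psize (l j) > 0 \<longrightarrow> psize (l j) < psize (l i)))
     \<and> (\<not> V \<longrightarrow> (\<forall>i. \<not> overlined (l i)))}"

lemma seqs_iff:
  "l \<in> seqs \<longleftrightarrow> l 0 = Pln 0 \<and> (\<forall>i. l i \<noteq> Ovl 0) \<and> finite (supp l)
     \<and> (\<forall>i j. overlined (l i) \<and> psize (l j) = psize (l i) \<longrightarrow> j \<le> i)"
proof -
  have "(\<forall>k\<ge>1. (\<forall>i j. l i = Ovl k \<and> l j = Ovl k \<longrightarrow> i = j) \<and>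
             (\<forall>i j. l i = Ovl k \<and> l j = Pln k \<longrightarrow> j < i))
    \<longleftrightarrow> (\<forall>i j. overlined (l i) \<and> psize (l j) = psize (l i) \<longrightarrow> j \<le> i)" (is "?L \<longleftrightarrow> ?R")
    if no0: "\<forall>i. l i \<noteq> Ovl 0"
  proof
    assume L: ?L
    show ?R
    proof (intro allI impI)
      fix i j
      assume "overlined (l i) \<and> psize (l j) = psize (l i)"
      then obtain k where k: "l i = Ovl k" "psize (l j) = k" by (cases "l i") auto
      then have "k \<ge> 1" using no0 by (cases k) auto
      with L k show "j \<le> i" by (cases "l j") (auto intro: less_imp_le)
    qed
  next
    assume R: ?R
    have "i = j" if "l i = Ovl k" "l j = Ovl k" for i j k
      using R[rule_format, of i j] R[rule_format, of j i] that by auto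
    moreover have "j < i" if "l i = Ovl k" "l j = Pln k" for i j k
    proof -
      have "j \<le> i" using R[rule_format, of i j] that by auto
      moreover have "j \<noteq> i" using that by auto
      ultimately show ?thesis by simp
    qed
    ultimately show ?L by blast
  qed
  then show ?thesis unfolding seqs_def supp_def by auto
qed

context
  fixes l :: "nat \<Rightarrow> part"
  assumes l: "l \<in> seqs"
begin

text \<open>The order and the sizes could disagree only if the earlier part were over-lined and had
  the same size as the later one, but an over-lined part is the last of its size.\<close>

lemma seqs_le_iff:
  assumes "i < j"
  shows "l j \<le> l i \<longleftrightarrow> psize (l j) \<le> psize (l i)"
proof -
  have "\<not> (overlined (l i) \<and> psize (l j) = psize (l i))"
    using l assms unfolding seqs_iff by (meson leD)
  then show ?thesis by (auto simp: less_eq_part_def)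
qed

lemma last_in_block: "m \<ge> 1 \<Longrightarrow> psum u m \<in> {psum u (m - 1)<..psum u m}"
  by auto

lemma block_min_in:
  assumes "m \<ge> 1"
  obtains i where "i \<in> {psum u (m - 1)<..psum u m}" "block_min u l m = l i"
proof -
  have "block_min u l m \<in> l ` {psum u (m - 1)<..psum u m}"
    unfolding block_min_def using last_in_block[OF assms] by (intro Min_in) auto
  then show ?thesis using that by auto
qed

lemma block_max_in:
  assumes "m \<ge> 1"
  obtains i where "i \<in> {psum u (m - 1)<..psum u m}" "block_max u l m = l i"
proof -
  have "block_max u l m \<in> l ` {psum u (m - 1)<..psum u m}"
    unfolding block_max_def using last_in_block[OF assms] by (intro Max_in) auto
  then show ?thesis using that by auto
qed

lemma block_min_le: "i \<in> {psum u (m - 1)<..psum u m} \<Longrightarrow> block_min u l m \<le> l i"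
  unfolding block_min_def by (intro Min_le) auto

lemma block_max_ge: "i \<in> {psum u (m - 1)<..psum u m} \<Longrightarrow> l i \<le> block_max u l m"
  unfolding block_max_def by (intro Max_ge) auto

text \<open>Conditions on adjacent blocks suffice: the comparison of distant blocks passes through
  the last element of each block in between.\<close>

lemma weak_iff:
  "(\<forall>m\<ge>1. block_min u l m \<ge> block_max u l (m + 1))
    \<longleftrightarrow> (\<forall>i j. prec i j \<longrightarrow> psize (l j) \<le> psize (l i))" (is "?L \<longleftrightarrow> ?R")
proof
  assume L: ?L
  have step: "l j \<le> l i" if "i \<in> {psum u (a - 1)<..psum u a}" "j \<in> {psum u a<..psum u (a + 1)}"
    "a \<ge> 1" for i j a
  proof -
    have "l j \<le> block_max u l (a + 1)" by (rule block_max_ge) (use that in simp)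
    also have "\<dots> \<le> block_min u l a" using L that(3) by blast
    also have "\<dots> \<le> l i" using that(1) by (rule block_min_le)
    finally show ?thesis .
  qed
  have *: "l j \<le> l i" if "i \<in> {psum u (a - 1)<..psum u a}" "j \<in> {psum u (a + d)<..psum u (a + d + 1)}"
    "a \<ge> 1" for i j a d
    using that
  proof (induction d arbitrary: j)
    case 0
    then show ?case using step by simp
  next
    case (Suc d)
    have "l (psum u (a + d + 1)) \<le> l i" using Suc by (intro Suc.IH) auto
    moreover have "l j \<le> l (psum u (a + d + 1))" by (rule step[of _ "a + d + 1"]) (use Suc in auto)
    ultimately show ?case by simp
  qed
  show ?R
  proof (intro allI impI)
    fix i j
    assume "prec i j"
    then obtain a b where ab: "1 \<le> a" "a < b" "i \<in> {psum u (a - 1)<..psum u a}"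
        "j \<in> {psum u (b - 1)<..psum u b}" by (rule prec_cases)
    have "l j \<le> l i" by (rule *[of _ a _ "b - a - 1"]) (use ab in auto)
    then show "psize (l j) \<le> psize (l i)" by (rule psize_mono)
  qed
next
  assume R: ?R
  show ?L
  proof (intro allI impI)
    fix m :: nat
    assume m: "m \<ge> 1"
    obtain i where i: "i \<in> {psum u (m - 1)<..psum u m}" "block_min u l m = l i"
      using block_min_in m by blast
    obtain j where j: "j \<in> {psum u (m + 1 - 1)<..psum u (m + 1)}" "block_max u l (m + 1) = l j"
      by (rule block_max_in[of "m + 1"]) auto
    have "prec i j" using i j m by (intro prec_blocks) auto
    then show "block_min u l m \<ge> block_max u l (m + 1)"
      using R seqs_le_iff prec_less i j by auto
  qed
qed

lemma strict_iff:
  assumes weak: "\<forall>i j. prec i j \<longrightarrow> psize (l j) \<le> psize (l i)"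
  shows "(\<forall>m\<ge>1. block_min u l m > Pln 0 \<longrightarrow>
       int (psize (block_min u l m)) - int (psize (block_max u l (m + 1))) > 0)
    \<longleftrightarrow> (\<forall>i j. prec i j \<and> psize (l j) > 0 \<longrightarrow> psize (l j) < psize (l i))" (is "?L \<longleftrightarrow> ?R")
proof
  have no0: "l i \<noteq> Ovl 0" for i using l by (auto simp: seqs_iff)
  assume L: ?L
  show ?R
  proof (intro allI impI)
    fix i j
    assume *: "prec i j \<and> psize (l j) > 0"
    then have "prec i j" ..
    then obtain a b where ab: "1 \<le> a" "a < b" "i \<in> {psum u (a - 1)<..psum u a}"
        "j \<in> {psum u (b - 1)<..psum u b}" by (rule prec_cases)
    obtain k where k: "k \<in> {psum u (a - 1)<..psum u a}" "block_min u l a = l k"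
      using block_min_in ab(1) by blast
    have "prec k j" using k ab by (intro prec_blocks) auto
    \<comment> \<open>The hypothesis concerns only blocks with positive minimum; here positivity is
      inherited from the later positive part \<open>l j\<close>.\<close>
    then have "0 < psize (l k)" using weak * by (metis order_less_le_trans)
    then have "psize (block_max u l (a + 1)) < psize (block_min u l a)"
      using L ab(1) k(2) no0 Pln_0_less_iff by auto
    also have "\<dots> \<le> psize (l i)" using block_min_le[OF ab(3)] by (rule psize_mono)
    finally have less: "psize (block_max u l (a + 1)) < psize (l i)" .
    have "psize (l j) \<le> psize (block_max u l (a + 1))"
    proof (cases "b = a + 1")
      case True
      then show ?thesis using block_max_ge[of j "a + 1"] ab(4) psize_mono by auto
    next
      case False
      then have "prec (psum u (a + 1)) j"
        using ab by (intro prec_blocks[of _ "a + 1" _ b] last_in_block) auto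
      then have "psize (l j) \<le> psize (l (psum u (a + 1)))" using weak by auto
      also have "\<dots> \<le> psize (block_max u l (a + 1))"
        by (intro psize_mono block_max_ge last_in_block) simp
      finally show ?thesis .
    qed
    with less show "psize (l j) < psize (l i)" by simp
  qed
next
  have no0: "l i \<noteq> Ovl 0" for i using l by (auto simp: seqs_iff)
  assume R: ?R
  show ?L
  proof (intro allI impI)
    fix m :: nat
    assume m: "m \<ge> 1" "block_min u l m > Pln 0"
    obtain i where i: "i \<in> {psum u (m - 1)<..psum u m}" "block_min u l m = l i"
      using block_min_in m(1) by blast
    obtain j where j: "j \<in> {psum u (m + 1 - 1)<..psum u (m + 1)}" "block_max u l (m + 1) = l j"
      by (rule block_max_in[of "m + 1"]) auto
    have "prec i j" using i j m by (intro prec_blocks) auto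
    moreover have "psize (l i) > 0" using m(2) i(2) no0 Pln_0_less_iff by auto
    ultimately have "psize (l j) < psize (l i)" using R by (cases "psize (l j) = 0") auto
    then show "int (psize (block_min u l m)) - int (psize (block_max u l (m + 1))) > 0"
      using i j by simp
  qed
qed

end

lemma block_overpartitions_eq: "block_overpartitions u = admissible False True"
  unfolding block_overpartitions_def admissible_def
  using weak_iff by (auto simp: seqs_iff)

lemma block_partitions_eq: "block_partitions u = admissible False False"
proof -
  have "(\<forall>i\<ge>1. \<not> overlined (l i)) \<longleftrightarrow> (\<forall>i. \<not> overlined (l i))"
    if "l \<in> admissible False True" for l
    using that by (auto simp: admissible_def) (metis Suc_leI overlined.simps(1) gr0I)
  then show ?thesis
    unfolding block_partitions_def block_overpartitions_eq by (auto simp: admissible_def)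
qed

lemma block_strict_overpartitions_eq: "block_strict_overpartitions u = admissible True True"
proof -
  have "l \<in> block_strict_overpartitions u \<longleftrightarrow> l \<in> admissible True True" for l
  proof (cases "l \<in> admissible False True")
    case True
    then have "l \<in> seqs" "\<forall>i j. prec i j \<longrightarrow> psize (l j) \<le> psize (l i)"
      by (auto simp: admissible_def seqs_iff)
    from strict_iff[OF this] True show ?thesis
      unfolding block_strict_overpartitions_def block_overpartitions_eq
      by (auto simp: admissible_def)
  next
    case False
    then show ?thesis
      unfolding block_strict_overpartitions_def block_overpartitions_eq
      by (auto simp: admissible_def)
  qed
  then show ?thesis by blast
qed

end

section \<open>Adding and removing the first column\<close>

fun inc :: "part \<Rightarrow> part" where
  "inc (Pln k) = Pln (Suc k)"
| "inc (Ovl k) = Ovl (Suc k)"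

text \<open>There is no over-lined zero, so \<open>Ovl 1\<close> becomes \<open>Pln 0\<close>. This
  is the only over-lining lost with the first column.\<close>

fun dec :: "part \<Rightarrow> part" where
  "dec (Pln k) = Pln (k - 1)"
| "dec (Ovl k) = (if k \<le> 1 then Pln 0 else Ovl (k - 1))"

lemma psize_inc [simp]: "psize (inc p) = Suc (psize p)"
  by (cases p) auto

lemma overlined_inc [simp]: "overlined (inc p) = overlined p"
  by (cases p) auto

lemma inc_neq [simp]: "inc p \<noteq> Pln 0" "inc p \<noteq> Ovl 0"
  by (cases p; simp)+

lemma inc_eq_Ovl_iff: "inc p = Ovl (Suc i) \<longleftrightarrow> p = Ovl i"
  by (cases p) auto

lemma psize_dec [simp]: "psize (dec p) = psize p - 1"
  by (cases p) auto

lemma dec_inc: "p \<noteq> Ovl 0 \<Longrightarrow> dec (inc p) = p"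
  by (cases p) auto

lemma inc_dec: "p \<noteq> Pln 0 \<Longrightarrow> p \<noteq> Ovl 0 \<Longrightarrow> p \<noteq> Ovl 1 \<Longrightarrow> inc (dec p) = p"
  by (cases p) auto

lemma overlined_dec: "overlined (dec p) \<longleftrightarrow> overlined p \<and> psize p > 1"
  by (cases p) auto

lemma dec_neq [simp]: "dec p \<noteq> Ovl 0"
  by (cases p) auto

text \<open>
  The flag \<open>b\<close> over-lines the last part of size 1. If the new column repeats the next one, there is
  no such part, and \<open>Max {}\<close> has no effect.
\<close>

definition add_column :: "bool \<Rightarrow> nat set \<Rightarrow> (nat \<Rightarrow> part) \<Rightarrow> nat \<Rightarrow> part" where
  "add_column b A l j = (if j \<notin> A then Pln 0
     else if b \<and> l j = Pln 0 \<and> j = Max (A - supp l) then Ovl 1 else inc (l j))"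

lemma supp_add_column [simp]: "supp (add_column b A l) = A"
  by (auto simp: supp_def add_column_def)

lemma psize_add_column: "psize (add_column b A l j) = (if j \<in> A then Suc (psize (l j)) else 0)"
  by (auto simp: add_column_def)

lemma overlined_add_column:
  "overlined (add_column b A l j) \<longleftrightarrow>
     j \<in> A \<and> (overlined (l j) \<or> b \<and> l j = Pln 0 \<and> j = Max (A - supp l))"
  by (auto simp: add_column_def)

lemma dec_add_column:
  assumes "\<And>j. l j \<noteq> Ovl 0" "supp l \<subseteq> A"
  shows "dec \<circ> add_column b A l = l"
proof
  fix j
  have "l j = Pln 0" if "j \<notin> A" using assms(2) that by (auto simp: supp_def)
  then show "(dec \<circ> add_column b A l) j = l j"
    using dec_inc[OF assms(1)[of j]] by (auto simp: add_column_def)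
qed

text \<open>Together with \<open>dec_add_column\<close> this recovers the flag and the old sequence:
  \<open>inc\<close> never produces \<open>Ovl 1\<close> from a legitimate value.\<close>

lemma ex_Ovl_1_add_column:
  assumes "\<And>j. l j \<noteq> Ovl 0" "supp l \<subseteq> A" "finite A" "b \<longrightarrow> supp l \<noteq> A"
  shows "(\<exists>j. add_column b A l j = Ovl 1) \<longleftrightarrow> b"
proof
  show "\<exists>j. add_column b A l j = Ovl 1 \<Longrightarrow> b"
    using assms(1) inc_eq_Ovl_iff[of _ 0] by (auto simp: add_column_def split: if_splits)
next
  assume b
  then have "Max (A - supp l) \<in> A - supp l" using assms by (intro Max_in) auto
  then have "add_column b A l (Max (A - supp l)) = Ovl 1"
    using \<open>b\<close> by (auto simp: add_column_def supp_def)
  then show "\<exists>j. add_column b A l j = Ovl 1" by blast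
qed

context blocks
begin

definition ideal :: "nat set \<Rightarrow> bool" where
  "ideal A \<longleftrightarrow> (\<forall>i j. prec i j \<and> j \<in> A \<longrightarrow> i \<in> A)"

text \<open>
  In a chain of columns that belongs to a sequence in $\overline{\mathcal D}(U)$, no initial union of
  blocks is skipped.
\<close>

definition next_column :: "bool \<Rightarrow> nat set \<Rightarrow> nat set \<Rightarrow> bool" where
  "next_column D A B \<longleftrightarrow> B \<subseteq> A \<and> (D \<longrightarrow> (\<forall>i j. prec i j \<and> j \<in> A \<longrightarrow> i \<in> B))"

lemma admissibleD:
  assumes "l \<in> admissible D V"
  shows "l 0 = Pln 0" "l i \<noteq> Ovl 0" "finite (supp l)"
    "overlined (l i) \<Longrightarrow> psize (l j) = psize (l i) \<Longrightarrow> j \<le> i"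
    "prec i j \<Longrightarrow> psize (l j) \<le> psize (l i)"
    "prec i j \<Longrightarrow> D \<Longrightarrow> psize (l j) > 0 \<Longrightarrow> psize (l j) < psize (l i)"
    "overlined (l i) \<Longrightarrow> V"
    "psize (l i) = 0 \<longleftrightarrow> l i = Pln 0"
  using assms psize_eq_0_iff[of "l i"] unfolding admissible_def by blast+

lemma in_supp_iff: "l \<in> admissible D V \<Longrightarrow> i \<in> supp l \<longleftrightarrow> psize (l i) > 0"
  using admissibleD(8)[of l D V i] by (auto simp: supp_def)

lemma supp_admissible:
  assumes "l \<in> admissible D V"
  shows "finite (supp l)" "0 \<notin> supp l" "ideal (supp l)"
proof -
  show "finite (supp l)" "0 \<notin> supp l" using admissibleD[OF assms] by (auto simp: supp_def)
  show "ideal (supp l)"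
    unfolding ideal_def in_supp_iff[OF assms] using admissibleD(5)[OF assms] by (meson order_less_le_trans)
qed

lemma add_column_admissible:
  assumes l: "l \<in> admissible D V" and A: "finite A" "0 \<notin> A" "ideal A"
    and nxt: "next_column D A (supp l)" and b: "b \<longrightarrow> V"
  shows "add_column b A l \<in> admissible D V"
proof -
  let ?l = "add_column b A l"
  note lD = admissibleD[OF l]
  have sub: "supp l \<subseteq> A" using nxt by (simp add: next_column_def)
  have "j \<le> i" if ol: "overlined (?l i)" and eq: "psize (?l j) = psize (?l i)" for i j
  proof -
    have ij: "i \<in> A" "j \<in> A" "psize (l j) = psize (l i)"
      using ol eq by (auto simp: overlined_add_column psize_add_column split: if_splits)
    \<comment> \<open>An over-lined part is either an old one or the new \<open>Ovl 1\<close>. The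
      latter competes only with the elements of \<open>A\<close> outside \<open>supp l\<close>, and
      it sits at their maximum.\<close>
    from ol consider "overlined (l i)" | "l i = Pln 0" "i = Max (A - supp l)"
      by (auto simp: overlined_add_column)
    then show ?thesis
    proof cases
      case 1
      then show ?thesis using lD(4) ij(3) by blast
    next
      case 2
      then have "j \<in> A - supp l" using ij lD(8)[of j] by (auto simp: supp_def)
      then show ?thesis using 2 A(1) by auto
    qed
  qed
  moreover have "psize (?l j) \<le> psize (?l i)
      \<and> (D \<and> psize (?l j) > 0 \<longrightarrow> psize (?l j) < psize (?l i))" if "prec i j" for i j
  proof (cases "j \<in> A")
    case True
    then have i: "i \<in> A" using A(3) that by (auto simp: ideal_def)
    have "psize (l j) < psize (l i)" if D
    proof (cases "psize (l j) = 0")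
      case True
      \<comment> \<open>In this case \<open>j\<close> lies in \<open>A\<close> but not in the next
        column, and \<open>next_column\<close> keeps \<open>i\<close> in that column.\<close>
      have "i \<in> supp l" using nxt \<open>D\<close> \<open>prec i j\<close> \<open>j \<in> A\<close> by (auto simp: next_column_def)
      then show ?thesis using True in_supp_iff[OF l] by simp
    next
      case False
      then show ?thesis using lD(6) \<open>prec i j\<close> \<open>D\<close> by simp
    qed
    then show ?thesis using i True lD(5)[OF that] by (simp add: psize_add_column)
  qed (simp add: psize_add_column)
  moreover have "\<not> overlined (?l i)" if "\<not> V" for i
    using that lD(7)[of i] b by (auto simp: overlined_add_column)
  ultimately show ?thesis
    using A unfolding admissible_def by (auto simp: add_column_def)
qed

text \<open>The flag records the \<open>Ovl 1\<close> that \<open>dec\<close> erases. Its position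
  need not be stored: an over-lined part is the last of its size, hence the largest element lost
  between the first two columns.\<close>

lemma admissible_remove_column:
  assumes l: "l \<in> admissible D V"
  obtains b l' where "l' \<in> admissible D V" "next_column D (supp l) (supp l')"
    "b \<longrightarrow> V \<and> supp l' \<noteq> supp l" "l = add_column b (supp l) l'"
proof -
  note lD = admissibleD[OF l]
  define l' where "l' = dec \<circ> l"
  define b where "b \<longleftrightarrow> (\<exists>j. l j = Ovl 1)"
  have ps: "psize (l' i) = psize (l i) - 1" for i by (simp add: l'_def)
  have supp': "i \<in> supp l' \<longleftrightarrow> psize (l i) > 1" for i
    using psize_eq_0_iff[of "l' i"] ps[of i] by (auto simp: supp_def l'_def)
  have suppl: "i \<in> supp l \<longleftrightarrow> psize (l i) > 0" for i by (rule in_supp_iff[OF l])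
  have sub: "supp l' \<subseteq> supp l" using supp' suppl by auto
  have "l' \<in> admissible D V"
  proof -
    have "l' 0 = Pln 0" "l' i \<noteq> Ovl 0" "finite (supp l')" for i
      using lD(1) sub lD(3) finite_subset by (auto simp: l'_def)
    moreover have "j \<le> i" if "overlined (l' i)" "psize (l' j) = psize (l' i)" for i j
    proof -
      have "overlined (l i)" "psize (l i) > 1" using that(1) by (auto simp: l'_def overlined_dec)
      moreover have "psize (l j) = psize (l i)" using that(2) calculation by (simp add: ps)
      ultimately show ?thesis using lD(4) by blast
    qed
    moreover have "psize (l' j) \<le> psize (l' i)" if "prec i j" for i j
      using lD(5)[OF that] by (simp add: ps)
    moreover have "psize (l' j) < psize (l' i)" if "prec i j" D "psize (l' j) > 0" for i j
      using lD(6)[OF that(1,2)] that(3) by (simp add: ps)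
    moreover have "\<not> overlined (l' i)" if "\<not> V" for i
      using lD(7)[of i] that by (auto simp: l'_def overlined_dec)
    ultimately show ?thesis unfolding admissible_def by blast
  qed
  moreover have "next_column D (supp l) (supp l')"
    unfolding next_column_def supp' suppl using sub lD(6) by fastforce
  moreover have "b \<longrightarrow> V \<and> supp l' \<noteq> supp l"
  proof
    assume b
    then obtain j where j: "l j = Ovl 1" by (auto simp: b_def)
    then have "j \<in> supp l - supp l'" using supp' suppl by simp
    then show "V \<and> supp l' \<noteq> supp l" using lD(7)[of j] j by auto
  qed
  moreover have "l = add_column b (supp l) l'"
  proof
    fix j
    show "l j = add_column b (supp l) l' j"
    proof (cases "l j = Ovl 1")
      case True
      have "j \<in> supp l - supp l'" using supp' suppl True by simp
      moreover have "i \<le> j" if "i \<in> supp l - supp l'" for i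
        using that supp' suppl True lD(4)[of j i] by auto
      ultimately have "Max (supp l - supp l') = j"
        using lD(3) by (intro Max_eqI) auto
      moreover have "b" "l' j = Pln 0" using True by (auto simp: b_def l'_def)
      ultimately show ?thesis using True by (auto simp: add_column_def supp_def)
    next
      case False
      have "\<not> (b \<and> l' j = Pln 0 \<and> j = Max (supp l - supp l'))" if "j \<in> supp l"
      proof
        assume *: "b \<and> l' j = Pln 0 \<and> j = Max (supp l - supp l')"
        then obtain i where i: "l i = Ovl 1" by (auto simp: b_def)
        then have "i \<in> supp l - supp l'" using supp' suppl by simp
        then have "i \<le> j" using * lD(3) by auto
        moreover have "l' j = Pln 0" using * by blast
        then have "j \<notin> supp l'" by (simp add: supp_def)
        then have "psize (l j) = 1" using that suppl supp' by simp
        then have "j \<le> i" using lD(4)[of i j] i by auto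
        ultimately show False using i False by simp
      qed
      then show ?thesis
        using False lD(2)[of j] inc_dec[of "l j"] by (auto simp: add_column_def supp_def l'_def)
    qed
  qed
  ultimately show ?thesis using that by blast
qed

end

lemma fin_fibres_image:
  assumes "inj_on f S" "\<And>x. x \<in> S \<Longrightarrow> \<mu> (f x) = N + \<nu> x" "fin_fibres \<mu> (f ` S)"
  shows "fin_fibres \<nu> S"
  unfolding fin_fibres_def
proof
  fix M
  have "f ` {x \<in> S. \<nu> x = M} \<subseteq> {y \<in> f ` S. \<mu> y = N + M}" using assms(2) by auto
  moreover have "inj_on f {x \<in> S. \<nu> x = M}" using assms(1) by (auto simp: inj_on_def)
  moreover have "finite {y \<in> f ` S. \<mu> y = N + M}" using assms(3) by (simp add: fin_fibres_def)
  ultimately show "finite {x \<in> S. \<nu> x = M}" by (meson finite_imageD finite_subset)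
qed

section \<open>The monomial of a sequence and the share of its first column\<close>

definition columns :: "(nat \<Rightarrow> part) \<Rightarrow> nat set" where
  "columns l = {i. Pln 0 < Ovl i \<and> Ovl i \<le> maxpart l}"

lemma columns_eq:
  assumes "finite (supp l)"
  shows "columns l = {i. 1 \<le> i \<and> (\<exists>j\<ge>1. i \<le> psize (l j))}"
proof -
  have "l ` {1..} \<subseteq> insert (Pln 0) (l ` supp l)" by (auto simp: supp_def)
  then have "finite (l ` {1..})" by (rule finite_subset) (use assms in simp)
  then have "Ovl i \<le> maxpart l \<longleftrightarrow> (\<exists>j\<ge>1. i \<le> psize (l j))" for i
    unfolding maxpart_def by (subst Max_ge_iff) (auto simp: Ovl_le_iff)
  moreover have "Pln 0 < Ovl i \<longleftrightarrow> 1 \<le> i" for i by (auto simp: less_part_def less_eq_part_def)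
  ultimately show ?thesis by (simp add: columns_def)
qed

lemma finite_columns:
  assumes "finite (supp l)"
  shows "finite (columns l)"
proof (rule finite_subset)
  show "columns l \<subseteq> (\<Union>j\<in>supp l. {..psize (l j)})"
  proof
    fix i
    assume "i \<in> columns l"
    then obtain j where "1 \<le> i" "i \<le> psize (l j)" unfolding columns_eq[OF assms] by auto
    moreover from this have "j \<in> supp l" by (cases "l j = Pln 0") (auto simp: supp_def)
    ultimately show "i \<in> (\<Union>j\<in>supp l. {..psize (l j)})" by auto
  qed
qed (use assms in auto)

definition gf_mset :: "(nat \<Rightarrow> nat) \<Rightarrow> (nat \<Rightarrow> part) \<Rightarrow> indet multiset" where
  "gf_mset s l = (\<Sum>i\<in>columns l. {#Colour (conj_part l i)#}) + replicate_mset (weight s l) Qvar"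

lemma gf_term_eq_mon: "gf_term u n l = mon (gf_mset (sseq u n) l)"
  unfolding gf_term_def colour_def gf_mset_def columns_def
  by (simp add: mon_add mon_sum mon_replicate mps_var_eq_mon)

definition column_mset :: "(nat \<Rightarrow> nat) \<Rightarrow> bool \<Rightarrow> nat set \<Rightarrow> indet multiset" where
  "column_mset s b A = {#Colour ((if b then Ovl else Pln) (card A))#} + replicate_mset (sum s A) Qvar"

lemma mon_column_mset:
  "mon (column_mset s b A) = col ((if b then Ovl else Pln) (card A)) * qvar ^ sum s A"
  unfolding column_mset_def mon_add mon_replicate mps_var_eq_mon ..

text \<open>Adding a column shifts the conjugate by one place: index 1 describes the new column and
  index i + 1 the old column i. The condition on \<open>b\<close> guarantees that a requested
  \<open>Ovl 1\<close> really occurs.\<close>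

lemma gf_mset_add_column:
  assumes "finite A" "A \<noteq> {}" "0 \<notin> A" "supp l \<subseteq> A" "\<And>j. l j \<noteq> Ovl 0" "b \<longrightarrow> supp l \<noteq> A"
  shows "gf_mset s (add_column b A l) = column_mset s b A + gf_mset s l"
proof -
  let ?l = "add_column b A l"
  have fin: "finite (supp l)" using assms finite_subset by blast
  have pos: "j \<in> A" if "0 < psize (l j)" for j
    using that assms(4) by (cases "l j = Pln 0") (auto simp: supp_def)
  have A1: "j \<ge> 1" if "j \<in> A" for j using that assms(3) by (cases j) auto
  have cols: "columns ?l = insert 1 (Suc ` columns l)"
  proof (rule set_eqI)
    fix i
    have *: "i \<in> columns ?l \<longleftrightarrow> 1 \<le> i \<and> (\<exists>j\<in>A. i \<le> Suc (psize (l j)))"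
      using A1 assms(1) by (subst columns_eq) (auto simp: psize_add_column split: if_splits)
    show "i \<in> columns ?l \<longleftrightarrow> i \<in> insert 1 (Suc ` columns l)"
    proof (cases "i \<le> 1")
      case True
      then have "i \<in> insert 1 (Suc ` columns l) \<longleftrightarrow> i = 1" by (auto simp: columns_eq[OF fin])
      moreover have "i \<in> columns ?l \<longleftrightarrow> i = 1" unfolding * using True assms(2) by auto
      ultimately show ?thesis by simp
    next
      case False
      then obtain k where k: "i = Suc k" "k \<ge> 1" by (cases i) auto
      have "(\<exists>j\<in>A. k \<le> psize (l j)) \<longleftrightarrow> (\<exists>j\<ge>1. k \<le> psize (l j))"
      proof
        assume "\<exists>j\<ge>1. k \<le> psize (l j)"
        then obtain j where j: "k \<le> psize (l j)" by blast
        then have "j \<in> A" using k(2) pos by simp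
        with j show "\<exists>j\<in>A. k \<le> psize (l j)" by blast
      qed (use A1 in blast)
      then show ?thesis unfolding * using k by (auto simp: columns_eq[OF fin])
    qed
  qed
  have col1: "conj_part ?l 1 = (if b then Ovl else Pln) (card A)"
  proof -
    have "{j. j \<ge> 1 \<and> ?l j \<ge> Ovl 1} = A"
      using A1 by (auto simp: Ovl_le_iff psize_add_column split: if_splits)
    moreover have "(\<exists>j\<ge>1. ?l j = Ovl 1) \<longleftrightarrow> b"
    proof -
      have "(\<exists>j\<ge>1. ?l j = Ovl 1) \<longleftrightarrow> (\<exists>j. ?l j = Ovl 1)"
        using A1 unfolding add_column_def by auto
      then show ?thesis using ex_Ovl_1_add_column[OF assms(5,4,1,6)] by simp
    qed
    ultimately show ?thesis by (simp add: conj_part_def)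
  qed
  have colS: "conj_part ?l (Suc i) = conj_part l i" if "i \<ge> 1" for i
  proof -
    have "{j. j \<ge> 1 \<and> ?l j \<ge> Ovl (Suc i)} = {j. j \<ge> 1 \<and> l j \<ge> Ovl i}"
      using pos that by (auto simp: Ovl_le_iff psize_add_column split: if_splits)
    moreover have "?l j = Ovl (Suc i) \<longleftrightarrow> l j = Ovl i" for j
      using pos[of j] that by (auto simp: add_column_def inc_eq_Ovl_iff)
    ultimately show ?thesis by (simp add: conj_part_def)
  qed
  have "(\<Sum>i\<in>columns ?l. {#Colour (conj_part ?l i)#})
      = {#Colour (conj_part ?l 1)#} + (\<Sum>i\<in>columns l. {#Colour (conj_part ?l (Suc i))#})"
  proof -
    have "1 \<notin> Suc ` columns l" by (auto simp: columns_eq[OF fin])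
    then show ?thesis unfolding cols using finite_columns[OF fin]
      by (subst sum.insert) (auto simp: sum.reindex)
  qed
  also have "(\<Sum>i\<in>columns l. {#Colour (conj_part ?l (Suc i))#}) = (\<Sum>i\<in>columns l. {#Colour (conj_part l i)#})"
    using colS by (intro sum.cong) (auto simp: columns_eq[OF fin])
  finally have part1: "(\<Sum>i\<in>columns ?l. {#Colour (conj_part ?l i)#})
    = {#Colour ((if b then Ovl else Pln) (card A))#} + (\<Sum>i\<in>columns l. {#Colour (conj_part l i)#})"
    by (simp only: col1)
  have "weight s ?l = (\<Sum>i\<in>A. Suc (psize (l i)) * s i)"
  proof -
    have "{i. i \<ge> 1 \<and> ?l i \<noteq> Pln 0} = A" using A1 supp_add_column[of b A l] by (auto simp: supp_def)
    then show ?thesis unfolding weight_def by (simp add: psize_add_column)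
  qed
  also have "\<dots> = sum s A + (\<Sum>i\<in>A. psize (l i) * s i)" by (simp add: sum.distrib)
  also have "(\<Sum>i\<in>A. psize (l i) * s i) = weight s l"
    unfolding weight_def using assms(1,4) A1
    by (intro sum.mono_neutral_right) (auto simp: supp_def)
  finally show ?thesis
    unfolding gf_mset_def column_mset_def part1 by (intro multiset_eqI) simp
qed

section \<open>The recursion for generating functions with fixed support\<close>

context blocks
begin

text \<open>The size of a monomial bounds the number of columns and hence all parts. The colour of
  the first column bounds the cardinality of the support, which as an ideal then cannot reach
  far.\<close>

lemma fin_fibres_admissible: "fin_fibres (gf_mset s) (admissible D V)"
  unfolding fin_fibres_def
proof
  fix M
  \<comment> \<open>\<open>c\<close> bounds the sizes of all colours in \<open>M\<close>. A support
    reaching beyond U_c would contain 1, ..., U_c as well, so more than \<open>c\<close>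
    elements.\<close>
  define c where "c = Max (insert 0 ((\<lambda>x. case x of Colour p \<Rightarrow> psize p | Qvar \<Rightarrow> 0) ` set_mset M))"
  let ?N = "psum u c" and ?B = "{p. psize p \<le> size M}"
  have "?B \<subseteq> Pln ` {..size M} \<union> Ovl ` {..size M}"
  proof
    fix p
    assume "p \<in> ?B"
    then show "p \<in> Pln ` {..size M} \<union> Ovl ` {..size M}" by (cases p) auto
  qed
  then have "finite ?B" by (rule finite_subset) simp
  then have "finite {l. \<forall>x. (x \<in> {1..?N} \<longrightarrow> l x \<in> ?B) \<and> (x \<notin> {1..?N} \<longrightarrow> l x = Pln 0)}"
    by (intro finite_set_of_finite_funs) simp
  moreover have "{l \<in> admissible D V. gf_mset s l = M}
    \<subseteq> {l. \<forall>x. (x \<in> {1..?N} \<longrightarrow> l x \<in> ?B) \<and> (x \<notin> {1..?N} \<longrightarrow> l x = Pln 0)}"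
  proof (intro subsetI CollectI allI)
    fix l j
    assume "l \<in> {l \<in> admissible D V. gf_mset s l = M}"
    then have l: "l \<in> admissible D V" and M: "gf_mset s l = M" by auto
    note fin = supp_admissible(1)[OF l]
    have supp: "i \<in> supp l \<longleftrightarrow> psize (l i) > 0" for i by (rule in_supp_iff[OF l])
    have "psize (l j) \<le> size M"
    proof (cases "j = 0")
      case True
      then show ?thesis using admissibleD(1)[OF l] by simp
    next
      case False
      then have "{1..psize (l j)} \<subseteq> columns l"
        unfolding columns_eq[OF fin] by (auto intro!: exI[of _ j])
      then have "card {1..psize (l j)} \<le> card (columns l)" by (intro card_mono finite_columns fin)
      then have "psize (l j) \<le> card (columns l)" by simp
      also have "\<dots> \<le> size M" unfolding M[symmetric] gf_mset_def by simp
      finally show ?thesis .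
    qed
    moreover have "l j = Pln 0" if "j \<notin> {1..?N}"
    proof (rule ccontr)
      assume "l j \<noteq> Pln 0"
      then have j: "j \<in> supp l" by (simp add: supp_def)
      then have "j \<noteq> 0" using supp_admissible(2)[OF l] by metis
      then have jN: "?N < j" using that by auto
      have supp_pos: "0 < i" if "i \<in> supp l" for i
        using supp_admissible(2)[OF l] that by (cases i) auto
      have "{j. j \<ge> 1 \<and> l j \<ge> Ovl 1} = supp l"
        using supp_pos by (auto simp: Ovl_le_iff Suc_le_eq simp flip: supp)
      then have "psize (conj_part l 1) = card (supp l)" by (simp add: conj_part_def)
      moreover have "1 \<in> columns l"
        unfolding columns_eq[OF fin] using j supp \<open>j \<noteq> 0\<close> by (auto intro!: exI[of _ j])
      then have "Colour (conj_part l 1) \<in># M"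
        unfolding M[symmetric] gf_mset_def using finite_columns[OF fin] by (force simp: set_mset_sum)
      then have "psize (conj_part l 1) \<le> c"
        unfolding c_def by (intro Max_ge) (auto simp: image_iff intro!: bexI[of _ "Colour (conj_part l 1)"])
      ultimately have "card (supp l) \<le> c" by simp
      moreover have "insert j {1..?N} \<subseteq> supp l"
      proof -
        have "prec i j" if "i \<in> {1..?N}" for i using that jN by (auto simp: prec_def)
        then show ?thesis using supp_admissible(3)[OF l] j unfolding ideal_def by blast
      qed
      then have "card (insert j {1..?N}) \<le> card (supp l)" by (intro card_mono fin)
      moreover have "card (insert j {1..?N}) = Suc ?N" using jN by simp
      ultimately show False using psum_ge[of c] by simp
    qed
    ultimately show "(j \<in> {1..?N} \<longrightarrow> l j \<in> ?B) \<and> (j \<notin> {1..?N} \<longrightarrow> l j = Pln 0)" by blast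
  qed
  ultimately show "finite {l \<in> admissible D V. gf_mset s l = M}" by (rule rev_finite_subset)
qed

definition with_supp :: "bool \<Rightarrow> bool \<Rightarrow> nat set \<Rightarrow> (nat \<Rightarrow> part) set" where
  "with_supp D V A = {l \<in> admissible D V. supp l = A}"

definition gf :: "(nat \<Rightarrow> part) set \<Rightarrow> indet mps" where
  "gf L = mgf (gf_mset (sseq u n)) L"

definition supp_gf :: "bool \<Rightarrow> bool \<Rightarrow> nat set \<Rightarrow> indet mps" where
  "supp_gf D V A = gf (with_supp D V A)"

lemma supp_gf_not_ideal: "\<not> ideal A \<Longrightarrow> supp_gf D V A = 0"
proof -
  assume "\<not> ideal A"
  then have "with_supp D V A = {}" using supp_admissible(3) by (auto simp: with_supp_def)
  then show ?thesis by (simp add: supp_gf_def gf_def mgf_empty)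
qed

lemma supp_gf_empty: "supp_gf D V {} = 1"
proof -
  have "with_supp D V {} = {\<lambda>_. Pln 0}"
    by (auto simp: with_supp_def admissible_def supp_def)
  moreover have "columns (\<lambda>_. Pln 0) = {}" by (subst columns_eq) (auto simp: supp_def)
  ultimately show ?thesis
    by (simp add: supp_gf_def gf_def mgf_singleton gf_mset_def weight_def mon_empty)
qed

lemma with_supp_disjoint: "disjoint_family_on (with_supp D V) X"
  by (auto simp: disjoint_family_on_def with_supp_def)

lemma gf_UN_with_supp:
  assumes "finite X"
  shows "gf (\<Union>A\<in>X. with_supp D V A) = (\<Sum>A\<in>X. supp_gf D V A)"
  unfolding gf_def supp_gf_def
proof (rule mgf_UN[OF assms _ with_supp_disjoint])
  show "fin_fibres (gf_mset (sseq u n)) (\<Union>A\<in>X. with_supp D V A)"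
    by (rule fin_fibres_subset[OF fin_fibres_admissible]) (auto simp: with_supp_def)
qed

text \<open>The three parts of \<open>J\<close> describe the step to the next column: repetition of
  \<open>A\<close>, proper descent, and proper descent with over-lining if \<open>V\<close> permits
  it. The inverse map reads the flag from the presence of \<open>Ovl 1\<close> and applies
  \<open>dec\<close>.\<close>

lemma with_supp_eq_add_column:
  fixes D V :: bool
  assumes A: "finite A" "0 \<notin> A" "ideal A" "A \<noteq> {}"
  defines "L \<equiv> (\<Union>B\<in>{B. B \<subset> A \<and> next_column D A B}. with_supp D V B)"
  defines "J \<equiv> Pair False ` with_supp D V A \<union> (Pair False ` L \<union> Pair True ` (if V then L else {}))"
  shows "(\<lambda>(b, l). add_column b A l) ` J = with_supp D V A"
    and "inj_on (\<lambda>(b, l). add_column b A l) J"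
    and "(b, l) \<in> J \<Longrightarrow> gf_mset s (add_column b A l) = column_mset s b A + gf_mset s l"
proof -
  have J: "(b, l) \<in> J \<longleftrightarrow> l \<in> admissible D V \<and> next_column D A (supp l) \<and> (b \<longrightarrow> V \<and> supp l \<noteq> A)"
    for b l
  proof -
    have "next_column D A A" using A(3) by (simp add: next_column_def ideal_def)
    moreover have "next_column D A B \<Longrightarrow> B \<subset> A \<longleftrightarrow> B \<noteq> A" for B by (auto simp: next_column_def)
    moreover have "(b, l) \<in> J \<longleftrightarrow> \<not> b \<and> l \<in> with_supp D V A \<or> l \<in> L \<and> (b \<longrightarrow> V)"
      unfolding J_def by (cases b) auto
    ultimately show ?thesis by (auto simp: L_def with_supp_def)
  qed
  have inv: "dec \<circ> add_column b A l = l" "(\<exists>j. add_column b A l j = Ovl 1) \<longleftrightarrow> b"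
    if "(b, l) \<in> J" for b l
  proof -
    have l: "\<And>j. l j \<noteq> Ovl 0" "supp l \<subseteq> A" "b \<longrightarrow> supp l \<noteq> A"
      using that admissibleD(2) unfolding J next_column_def by blast+
    show "dec \<circ> add_column b A l = l" using l(1,2) by (rule dec_add_column)
    show "(\<exists>j. add_column b A l j = Ovl 1) \<longleftrightarrow> b"
      using l(1,2) A(1) l(3) by (rule ex_Ovl_1_add_column)
  qed
  show "inj_on (\<lambda>(b, l). add_column b A l) J"
  proof (rule inj_on_inverseI)
    fix p
    assume "p \<in> J"
    then show "(\<lambda>l. (\<exists>j. l j = Ovl 1, dec \<circ> l)) (case p of (b, l) \<Rightarrow> add_column b A l) = p"
      by (cases p) (simp only: prod.case inv)
  qed
  show "gf_mset s (add_column b A l) = column_mset s b A + gf_mset s l" if "(b, l) \<in> J"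
    using that A admissibleD(2) unfolding J next_column_def by (intro gf_mset_add_column) auto
  show "(\<lambda>(b, l). add_column b A l) ` J = with_supp D V A"
  proof (intro equalityI subsetI)
    fix l
    assume "l \<in> (\<lambda>(b, l). add_column b A l) ` J"
    then show "l \<in> with_supp D V A"
      using A add_column_admissible by (auto simp: J with_supp_def)
  next
    fix l
    assume "l \<in> with_supp D V A"
    then have l: "l \<in> admissible D V" "supp l = A" by (auto simp: with_supp_def)
    from l(1) obtain b l' where "l' \<in> admissible D V" "next_column D A (supp l')"
      "b \<longrightarrow> V \<and> supp l' \<noteq> A" "l = add_column b A l'"
      by (rule admissible_remove_column) (use l(2) in blast)
    then show "l \<in> (\<lambda>(b, l). add_column b A l) ` J" by (force simp: J)
  qed
qed

text \<open>Repetition of \<open>A\<close> contributes \<open>y * supp_gf D V A\<close>, which is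
  moved to the left; each proper descent contributes \<open>y\<close> without and \<open>x\<close>
  with over-lining.\<close>

lemma supp_gf_rec:
  fixes D V :: bool
  assumes A: "finite A" "0 \<notin> A" "ideal A" "A \<noteq> {}"
  defines "y \<equiv> col (Pln (card A)) * qvar ^ sum (sseq u n) A"
    and "x \<equiv> of_bool V * (col (Ovl (card A)) * qvar ^ sum (sseq u n) A)"
  shows "(1 - y) * supp_gf D V A = (y + x) * (\<Sum>B\<in>{B. B \<subset> A \<and> next_column D A B}. supp_gf D V B)"
proof -
  let ?s = "sseq u n" and ?X = "{B. B \<subset> A \<and> next_column D A B}"
  let ?\<nu> = "\<lambda>(b, l). column_mset ?s b A + gf_mset ?s l"
  define L where "L = (\<Union>B\<in>?X. with_supp D V B)"
  define J where "J = Pair False ` with_supp D V A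
    \<union> (Pair False ` L \<union> Pair True ` (if V then L else {}))"
  note J = with_supp_eq_add_column[OF A, where D = D and V = V, folded L_def, folded J_def]
  have \<nu>: "gf_mset ?s ((\<lambda>(b, l). add_column b A l) p) = {#} + ?\<nu> p" if "p \<in> J" for p
    using J(3) that by (cases p) auto
  have "fin_fibres (gf_mset ?s) ((\<lambda>(b, l). add_column b A l) ` J)"
    unfolding J(1) by (rule fin_fibres_subset[OF fin_fibres_admissible]) (auto simp: with_supp_def)
  from fin_fibres_image[OF J(2) \<nu> this] have fin: "fin_fibres ?\<nu> J" .
  have Pair: "mgf ?\<nu> (Pair b ` S) = mon (column_mset ?s b A) * gf S" for b S
    unfolding gf_def by (rule mgf_image) (auto simp: inj_on_def)
  have "supp_gf D V A = mgf ?\<nu> J"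
    using mgf_image[OF J(2), of "gf_mset ?s" "{#}" ?\<nu>, OF \<nu>]
    by (simp add: J(1) supp_gf_def gf_def mon_empty)
  also have "\<dots> = mgf ?\<nu> (Pair False ` with_supp D V A)
      + (mgf ?\<nu> (Pair False ` L) + mgf ?\<nu> (Pair True ` (if V then L else {})))"
  proof -
    have "with_supp D V A \<inter> L = {}" by (auto simp: L_def with_supp_def)
    then show ?thesis
      using fin unfolding J_def by (subst mgf_Un, simp, blast, subst mgf_Un) (auto intro: fin_fibres_subset)
  qed
  also have "\<dots> = y * supp_gf D V A + (y * gf L + x * gf L)"
    unfolding Pair mon_column_mset x_def y_def by (simp add: supp_gf_def gf_def mgf_empty)
  also have "gf L = (\<Sum>B\<in>?X. supp_gf D V B)"
    unfolding L_def using A(1) by (intro gf_UN_with_supp) (auto intro: finite_subset[of _ "Pow A"])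
  finally show ?thesis by (simp add: algebra_simps)
qed

end

section \<open>Factorization over the blocks\<close>

text \<open>By induction g R = h * w * asc_sum R for all proper nonempty \<open>R\<close>, and
  \<open>asc_sum_rec\<close> adds these values up. In the applications \<open>h\<close> is the
  weight of everything that can follow once the block is exhausted.\<close>

lemma asc_sum_solve:
  fixes g :: "nat set \<Rightarrow> 'a :: comm_ring_1"
  assumes "finite T" "T \<noteq> {}"
    and rec: "\<And>S. S \<subseteq> T \<Longrightarrow> S \<noteq> {} \<Longrightarrow> g S = w (card S) * (h + (\<Sum>R\<in>{R. R \<noteq> {} \<and> R \<subset> S}. g R))"
  shows "h + (\<Sum>R\<in>{R. R \<noteq> {} \<and> R \<subset> T}. g R) = h * asc_sum w T"
  using assms
proof (induction T rule: finite_psubset_induct)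
  case (psubset T)
  have "g R = h * (w (card R) * asc_sum w R)" if "R \<noteq> {}" "R \<subset> T" for R
  proof -
    have "h + (\<Sum>Q\<in>{Q. Q \<noteq> {} \<and> Q \<subset> R}. g Q) = h * asc_sum w R"
      by (rule psubset.IH[OF that(2,1)]) (use psubset.prems(2) that in blast)
    moreover have "R \<subseteq> T" using that by blast
    ultimately show ?thesis using psubset.prems(2)[of R] that by (simp add: mult_ac)
  qed
  then have "(\<Sum>R\<in>{R. R \<noteq> {} \<and> R \<subset> T}. g R)
      = h * (\<Sum>R\<in>{R. R \<noteq> {} \<and> R \<subset> T}. w (card R) * asc_sum w R)"
    unfolding sum_distrib_left by (intro sum.cong) auto
  then show ?case
    by (simp add: asc_sum_rec[OF psubset.hyps(1) psubset.prems(1), of w] distrib_left)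
qed

lemma const_coeff_var: "mps_coeff (mps_var v * f) {#} = 0"
  by (simp add: const_coeff_mult mps_var.rep_eq)

lemma const_coeff_one_minus: "mps_coeff (1 - mps_var v * f) {#} = 1"
  by (simp add: minus_mps.rep_eq one_mps.rep_eq const_coeff_var)

lemma mps_divide_eqI:
  fixes f g h :: "'v mps"
  assumes "mps_coeff g {#} = 1" "f = h * g"
  shows "f / g = h"
  using mps_right_inverse[OF assms(1)] by (simp add: assms(2) divide_mps_def mult.assoc)

lemma const_coeff_denom: "mps_coeff (denom a b e) {#} = 1"
  by (simp add: denom_def const_coeff_prod const_coeff_one_minus)

context blocks
begin

section \<open>The distinguished one-element blocks and the power of q\<close>

lemma n_0: "n 0 = 0"
  using n_incr by (simp add: increasing_seq_def)

lemma n_Suc: "n i < n (Suc i) \<or> n i = \<infinity> \<and> n (Suc i) = \<infinity>"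
  using n_incr by (simp add: increasing_seq_def)

lemma n_mono: "i \<le> j \<Longrightarrow> n i \<le> n j"
proof (rule lift_Suc_mono_le[of n])
  show "n i \<le> n (Suc i)" for i using n_Suc[of i] by (auto intro: less_imp_le)
qed

lemma n_less:
  assumes "i < j" "n i \<noteq> \<infinity>"
  shows "n i < n j"
proof -
  have "n i < n (Suc i)" using n_Suc[of i] assms(2) by auto
  also have "\<dots> \<le> n j" using assms(1) by (intro n_mono) simp
  finally show ?thesis .
qed

lemma n_ge: "enat i \<le> n i"
proof (induction i)
  case (Suc i)
  show ?case
  proof (cases "n (Suc i)")
    case (enat k)
    then have "n i < enat k" using n_Suc[of i] by auto
    with Suc have "enat i < enat k" by (rule order_le_less_trans)
    then show ?thesis using enat by simp
  qed simp
qed (simp add: n_0 zero_enat_def)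

text \<open>The exponent of q in a column that ends in block \<open>m\<close>: i - 1 in the gap
  before n_i, and i at n_i itself.\<close>

definition qexp :: "nat \<Rightarrow> nat" where
  "qexp m = card {j. j \<ge> 1 \<and> n j \<le> enat m}"

lemma qexp_gap:
  assumes "i \<ge> 1" "m \<in> gap n i"
  shows "qexp m = i - 1"
proof -
  have eq: "n j \<le> enat m \<longleftrightarrow> j \<le> i - 1" for j
  proof
    assume *: "n j \<le> enat m"
    show "j \<le> i - 1"
    proof (rule ccontr)
      assume "\<not> j \<le> i - 1"
      then have "n i \<le> n j" by (intro n_mono) simp
      then have "n i \<le> enat m" using * by (rule order_trans)
      then show False using assms(2) by (auto simp: gap_def dest: leD)
    qed
  next
    assume "j \<le> i - 1"
    then have "n j \<le> n (i - 1)" by (rule n_mono)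
    also have "\<dots> \<le> enat m" using assms(2) by (simp add: gap_def less_imp_le)
    finally show "n j \<le> enat m" .
  qed
  have "{j. j \<ge> 1 \<and> n j \<le> enat m} = {1..i - 1}" unfolding eq by auto
  then show ?thesis by (simp add: qexp_def)
qed

lemma qexp_head:
  assumes "n i = enat m"
  shows "qexp m = i"
proof -
  have eq: "n j \<le> enat m \<longleftrightarrow> j \<le> i" for j
    using n_mono[of j i] n_less[of i j] unfolding assms by (meson enat.distinct(1) leD leI)
  have "{j. j \<ge> 1 \<and> n j \<le> enat m} = {1..i}" unfolding eq by auto
  then show ?thesis by (simp add: qexp_def)
qed

abbreviation initial :: "nat \<Rightarrow> nat set" where
  "initial m \<equiv> {1..psum u m}"

abbreviation block :: "nat \<Rightarrow> nat set" where
  "block m \<equiv> {psum u (m - 1) + 1..psum u m}"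

lemma psum_pred: "m \<ge> 1 \<Longrightarrow> psum u m = psum u (m - 1) + u m"
  by (cases m) auto

text \<open>If n_j < m, then U_{n_j} belongs to the initial part. If n_j = m, the block has a single
  element, which the nonempty \<open>T\<close> contains. This is where the hypothesis on the blocks
  n_j makes the weight independent of \<open>T\<close>.\<close>

lemma sum_sseq:
  assumes m: "m \<ge> 1" and T: "T \<subseteq> block m" "T \<noteq> {}"
  shows "sum (sseq u n) (initial (m - 1) \<union> T) = qexp m"
proof -
  let ?A = "initial (m - 1) \<union> T" and ?J = "{j. j \<ge> 1 \<and> n j \<le> enat m}"
  let ?P = "\<lambda>p. \<exists>j\<ge>1. \<exists>k. n j = enat k \<and> p = psum u k"
  define f where "f j = psum u (the_enat (n j))" for j
  have fin: "finite ?A" using T(1) finite_subset by blast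
  have "bij_betw f ?J {p \<in> ?A. ?P p}"
  proof (rule bij_betwI')
    fix i j
    assume i: "i \<in> ?J" and j: "j \<in> ?J"
    then obtain a b where ab: "n i = enat a" "n j = enat b"
      by (metis (mono_tags, lifting) enat_ile mem_Collect_eq)
    have "i = j" if "a = b" using qexp_head ab that by metis
    then show "f i = f j \<longleftrightarrow> i = j"
      using ab strict_mono_eq[OF psum_strict_mono] by (auto simp: f_def)
  next
    fix j
    assume j: "j \<in> ?J"
    then obtain k where k: "n j = enat k" "k \<le> m"
      by (cases "n j") auto
    have "k \<ge> 1" using n_ge[of j] j k by simp
    have "psum u k \<in> ?A"
    proof (cases "k = m")
      case True
      then have "u m = 1" using u_n j k by auto
      then have "block m = {psum u m}" using psum_pred[OF m] by auto
      then show ?thesis using T True by auto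
    next
      case False
      then have "psum u k \<le> psum u (m - 1)" using k by (simp only: psum_le_iff)
      moreover have "psum u k \<ge> 1" using psum_ge[of k] \<open>k \<ge> 1\<close> by simp
      ultimately show ?thesis by simp
    qed
    then show "f j \<in> {p \<in> ?A. ?P p}" using j k by (auto simp: f_def)
  next
    fix p
    assume p: "p \<in> {p \<in> ?A. ?P p}"
    then obtain j k where jk: "j \<ge> 1" "n j = enat k" "p = psum u k" by blast
    have "psum u (m - 1) \<le> psum u m" by simp
    then have "p \<le> psum u m" using p T(1) by auto
    then have "k \<le> m" using jk by simp
    then show "\<exists>j\<in>?J. p = f j" using jk by (auto simp: f_def intro!: exI[of _ j])
  qed
  then have "card ?J = card {p \<in> ?A. ?P p}" by (rule bij_betw_same_card)
  also have "\<dots> = sum (sseq u n) ?A"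
    using fin by (simp add: sseq_def sum.If_cases Int_def)
  finally show ?thesis by (simp add: qexp_def)
qed

definition yvar :: "nat \<Rightarrow> nat \<Rightarrow> indet mps" where
  "yvar m i = yarg u m (qexp m) i"

text \<open>The factor \<open>of_bool V\<close> makes block partitions the case x = 0 of a common
  argument.\<close>

definition xvar :: "bool \<Rightarrow> nat \<Rightarrow> nat \<Rightarrow> indet mps" where
  "xvar V m i = of_bool V * xarg u m (qexp m) i"

text \<open>The total weight of a run of one or more equal columns, of which the last may be
  over-lined.\<close>

definition wvar :: "bool \<Rightarrow> nat \<Rightarrow> nat \<Rightarrow> indet mps" where
  "wvar V m i = (yvar m i + xvar V m i) * inverse (1 - yvar m i)"

text \<open>By \<open>asc_sum_rec\<close> this is the sum over all strict chains of nonempty proper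
  subsets of the block, the empty chain included. The full block is left out so that it can be
  required, permitted or forbidden.\<close>

definition block_gf :: "bool \<Rightarrow> nat \<Rightarrow> indet mps" where
  "block_gf V m = asc_sum (wvar V m) (block m)"

lemma yvar_inverse: "(1 - yvar m i) * inverse (1 - yvar m i) = 1"
  unfolding yvar_def yarg_def by (rule mps_right_inverse) (rule const_coeff_one_minus)

lemma wvar_mult: "(1 - yvar m i) * wvar V m i = yvar m i + xvar V m i"
  unfolding wvar_def by (subst mult.left_commute) (simp add: yvar_inverse)

lemma wvar_mult': "(1 - yvar m i) * (wvar V m i + 1) = 1 + xvar V m i"
  unfolding distrib_left wvar_mult by simp

lemma yvar_cancel:
  assumes "(1 - yvar m i) * f = (yvar m i + xvar V m i) * g"
  shows "f = wvar V m i * g"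
proof -
  have "f = inverse (1 - yvar m i) * ((1 - yvar m i) * f)"
    using yvar_inverse[of m i] by (simp add: mult_ac)
  then show ?thesis unfolding assms by (simp add: wvar_def mult_ac)
qed

lemma ideal_initial_Un:
  assumes m: "m \<ge> 1" and T: "T \<subseteq> block m"
    and "prec i j" "j \<in> initial (m - 1) \<union> T"
  shows "i \<in> initial (m - 1)"
proof -
  obtain k where k: "1 \<le> i" "i \<le> psum u k" "psum u k < j" using assms(3) by (auto simp: prec_def)
  have "psum u (m - 1) \<le> psum u m" by simp
  moreover have "j \<le> psum u (m - 1) \<or> j \<in> T" using assms(4) by auto
  moreover have "j \<in> T \<Longrightarrow> j \<le> psum u m" using T by auto
  ultimately have "j \<le> psum u m" by linarith
  with k(3) have "psum u k < psum u m" by (rule order_less_le_trans)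
  then have "k \<le> m - 1" by simp
  then have "psum u k \<le> psum u (m - 1)" by (simp only: psum_le_iff)
  with k(2) have "i \<le> psum u (m - 1)" by (rule order_trans)
  then show ?thesis using k(1) by simp
qed

lemma supp_gf_block_rec:
  assumes m: "m \<ge> 1" and T: "T \<subseteq> block m" "T \<noteq> {}"
  shows "supp_gf D V (initial (m - 1) \<union> T) = wvar V m (card T)
    * (\<Sum>B\<in>{B. B \<subset> initial (m - 1) \<union> T \<and> next_column D (initial (m - 1) \<union> T) B}. supp_gf D V B)"
proof (rule yvar_cancel)
  let ?A = "initial (m - 1) \<union> T"
  have fin: "finite T" using T(1) finite_subset by blast
  have "initial (m - 1) \<inter> T = {}" using T(1) by auto
  then have card: "card ?A = psum u (m - 1) + card T" using fin by (simp add: card_Un_disjoint)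
  have "ideal ?A" using ideal_initial_Un[OF m T(1)] by (auto simp: ideal_def)
  moreover have "finite ?A" "0 \<notin> ?A" "?A \<noteq> {}" using fin T by auto
  ultimately show "(1 - yvar m (card T)) * supp_gf D V ?A = (yvar m (card T) + xvar V m (card T))
      * (\<Sum>B\<in>{B. B \<subset> ?A \<and> next_column D ?A B}. supp_gf D V B)"
    using supp_gf_rec[of ?A D V] unfolding card sum_sseq[OF m T] yvar_def xvar_def yarg_def xarg_def by blast
qed

section \<open>Strict sequences: the contribution of one block\<close>

lemma block_finite: "T \<subseteq> block m \<Longrightarrow> finite T"
  by (erule finite_subset) simp

lemma block_nonempty: "m \<ge> 1 \<Longrightarrow> block m \<noteq> {}"
  using psum_pred[of m] u_pos[of m] by auto

lemma inj_on_initial_Un: "inj_on (\<lambda>S. initial (m - 1) \<union> S) {S. S \<subseteq> block m}"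
proof (rule inj_onI)
  fix S T
  assume *: "S \<in> {S. S \<subseteq> block m}" "T \<in> {S. S \<subseteq> block m}"
    "initial (m - 1) \<union> S = initial (m - 1) \<union> T"
  have "initial (m - 1) \<inter> block m = {}" by auto
  then show "S = T" using * by blast
qed

text \<open>All elements of the earlier blocks precede each element of \<open>T\<close>, so none of
  them may be dropped, whereas \<open>T\<close> may shrink to any proper subset, even the empty
  one.\<close>

lemma strict_predecessors:
  assumes m: "m \<ge> 1" and T: "T \<subseteq> block m" "T \<noteq> {}"
  shows "{B. B \<subset> initial (m - 1) \<union> T \<and> next_column True (initial (m - 1) \<union> T) B}
    = (\<lambda>S. initial (m - 1) \<union> S) ` {S. S \<subset> T}" (is "?L = ?R")
proof (intro equalityI subsetI)
  fix B
  assume B: "B \<in> ?L"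
  obtain j where j: "j \<in> T" using T(2) by blast
  have "prec i j" if "i \<in> initial (m - 1)" for i
    using that j T(1) by (auto simp: prec_def intro!: exI[of _ "m - 1"])
  then have "initial (m - 1) \<subseteq> B" using B j unfolding next_column_def by blast
  then have "B = initial (m - 1) \<union> (B \<inter> T)" "B \<inter> T \<subset> T" using B by auto
  then show "B \<in> ?R" by blast
next
  fix B
  assume "B \<in> ?R"
  then obtain S where S: "S \<subset> T" "B = initial (m - 1) \<union> S" by blast
  have "initial (m - 1) \<inter> block m = {}" by auto
  then have "B \<subset> initial (m - 1) \<union> T" using S T by blast
  moreover have "next_column True (initial (m - 1) \<union> T) B"
    unfolding next_column_def using ideal_initial_Un[OF m T(1)] S calculation by blast
  ultimately show "B \<in> ?L" by blast
qed

lemma strict_sum: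
  assumes "T \<subseteq> block m"
  shows "(\<Sum>B\<in>(\<lambda>S. initial (m - 1) \<union> S) ` {S. S \<subset> T}. supp_gf D V B) =
    (if T = {} then 0 else supp_gf D V (initial (m - 1))
      + (\<Sum>S\<in>{S. S \<noteq> {} \<and> S \<subset> T}. supp_gf D V (initial (m - 1) \<union> S)))"
proof -
  have "inj_on (\<lambda>S. initial (m - 1) \<union> S) {S. S \<subset> T}"
    using inj_on_initial_Un by (rule inj_on_subset) (use assms in auto)
  then have "(\<Sum>B\<in>(\<lambda>S. initial (m - 1) \<union> S) ` {S. S \<subset> T}. supp_gf D V B)
      = (\<Sum>S\<in>{S. S \<subset> T}. supp_gf D V (initial (m - 1) \<union> S))"
    by (simp add: sum.reindex)
  moreover have "{S. S \<subset> T} = insert {} {S. S \<noteq> {} \<and> S \<subset> T}" if "T \<noteq> {}" using that by auto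
  moreover have "finite {S. S \<noteq> {} \<and> S \<subset> T}"
    using block_finite[OF assms] by (auto intro: finite_subset[of _ "Pow T"])
  ultimately show ?thesis by auto
qed

lemma strict_block_sum:
  assumes m: "m \<ge> 1" and T: "T \<subseteq> block m" "T \<noteq> {}"
  shows "(\<Sum>B\<in>(\<lambda>S. initial (m - 1) \<union> S) ` {S. S \<subset> T}. supp_gf True V B)
    = supp_gf True V (initial (m - 1)) * asc_sum (wvar V m) T"
proof -
  let ?g = "\<lambda>S. supp_gf True V (initial (m - 1) \<union> S)" and ?h = "supp_gf True V (initial (m - 1))"
  have "?h + (\<Sum>S\<in>{S. S \<noteq> {} \<and> S \<subset> T}. ?g S) = ?h * asc_sum (wvar V m) T"
  proof (rule asc_sum_solve[OF block_finite[OF T(1)] T(2)])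
    fix S
    assume "S \<subseteq> T" "S \<noteq> {}"
    then have S: "S \<subseteq> block m" "S \<noteq> {}" using T by auto
    show "?g S = wvar V m (card S) * (?h + (\<Sum>R\<in>{R. R \<noteq> {} \<and> R \<subset> S}. ?g R))"
      unfolding supp_gf_block_rec[OF m S] strict_predecessors[OF m S] strict_sum[OF S(1)]
      using S(2) by simp
  qed
  then show ?thesis using strict_sum[OF T(1)] T(2) by simp
qed

text \<open>The extra factor is the weight of the full block, which a strict sequence filling block
  \<open>m\<close> cannot skip as a column.\<close>

definition strict_block_gf :: "bool \<Rightarrow> nat \<Rightarrow> indet mps" where
  "strict_block_gf V m = wvar V m (u m) * block_gf V m"

lemma initial_Un_block: "m \<ge> 1 \<Longrightarrow> initial (m - 1) \<union> block m = initial m"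
  using psum_pred[of m] by auto

lemma card_block: "m \<ge> 1 \<Longrightarrow> card (block m) = u m"
  using psum_pred[of m] by simp

lemma supp_gf_strict_initial: "supp_gf True V (initial k) = (\<Prod>m\<in>{1..k}. strict_block_gf V m)"
proof (induction k)
  case 0
  then show ?case using supp_gf_empty by simp
next
  case (Suc k)
  define m where "m = Suc k"
  have m: "m \<ge> 1" by (simp add: m_def)
  note B = m subset_refl block_nonempty[OF m]
  have "supp_gf True V (initial (m - 1) \<union> block m)
      = strict_block_gf V m * supp_gf True V (initial (m - 1))"
    unfolding supp_gf_block_rec[OF B] strict_predecessors[OF B] strict_block_sum[OF B]
      card_block[OF m] strict_block_gf_def block_gf_def by (simp only: mult_ac)
  then have "supp_gf True V (initial m) = strict_block_gf V m * supp_gf True V (initial k)"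
    unfolding initial_Un_block[OF m] by (simp only: m_def diff_Suc_1)
  then show ?case using Suc by (simp add: m_def mult.commute del: psum_Suc)
qed

text \<open>The column that ends with all of block \<open>m\<close> does not occur here, so only
  \<open>block_gf V m\<close> remains for this block.\<close>

lemma gf_strict_first_zero:
  assumes m: "m \<ge> 1"
  shows "gf {l \<in> admissible True V. initial (m - 1) \<subseteq> supp l \<and> supp l \<subset> initial m}
    = (\<Prod>k\<in>{1..m - 1}. strict_block_gf V k) * block_gf V m"
proof -
  let ?X = "(\<lambda>S. initial (m - 1) \<union> S) ` {S. S \<subset> block m}"
  have X: "{B. initial (m - 1) \<subseteq> B \<and> B \<subset> initial m} = ?X"
  proof (intro equalityI subsetI)
    fix B
    assume "B \<in> {B. initial (m - 1) \<subseteq> B \<and> B \<subset> initial m}"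
    then have "B = initial (m - 1) \<union> (B \<inter> block m)" "B \<inter> block m \<subset> block m"
      unfolding initial_Un_block[OF m, symmetric] by auto
    then show "B \<in> ?X" by blast
  next
    fix B
    assume "B \<in> ?X"
    moreover have "initial (m - 1) \<inter> block m = {}" by auto
    ultimately show "B \<in> {B. initial (m - 1) \<subseteq> B \<and> B \<subset> initial m}"
      unfolding initial_Un_block[OF m, symmetric] by blast
  qed
  have "{l \<in> admissible True V. initial (m - 1) \<subseteq> supp l \<and> supp l \<subset> initial m}
      = (\<Union>B\<in>?X. with_supp True V B)"
    unfolding X[symmetric] by (auto simp: with_supp_def)
  moreover have "finite {S. S \<subset> block m}" by (rule finite_subset[of _ "Pow (block m)"]) auto
  then have "finite ?X" by (rule finite_imageI)
  ultimately have "gf {l \<in> admissible True V. initial (m - 1) \<subseteq> supp l \<and> supp l \<subset> initial m}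
      = (\<Sum>B\<in>?X. supp_gf True V B)"
    by (simp only: gf_UN_with_supp)
  then show ?thesis
    unfolding strict_block_sum[OF m subset_refl block_nonempty[OF m]] supp_gf_strict_initial block_gf_def .
qed

section \<open>Weak sequences: the contribution of one block\<close>

definition initial_gf :: "bool \<Rightarrow> nat \<Rightarrow> indet mps" where
  "initial_gf V m = gf {l \<in> admissible False V. supp l \<subseteq> initial m}"

lemma initial_gf_eq_sum: "initial_gf V m = (\<Sum>B\<in>Pow (initial m). supp_gf False V B)"
proof -
  have "{l \<in> admissible False V. supp l \<subseteq> initial m} = (\<Union>B\<in>Pow (initial m). with_supp False V B)"
    by (auto simp: with_supp_def)
  then show ?thesis by (simp add: initial_gf_def gf_UN_with_supp)
qed

text \<open>A set that meets \<open>T\<close> but misses part of the earlier blocks is not an ideal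
  and contributes 0. The other sets lie inside the initial part or contain all of it.\<close>

lemma sum_Pow_initial_Un:
  assumes m: "m \<ge> 1" and T: "T \<subseteq> block m"
  shows "(\<Sum>B\<in>Pow (initial (m - 1) \<union> T). supp_gf False V B) = initial_gf V (m - 1)
    + (\<Sum>S\<in>{S. S \<noteq> {} \<and> S \<subseteq> T}. supp_gf False V (initial (m - 1) \<union> S))"
proof -
  let ?I = "initial (m - 1)" and ?X = "{S. S \<noteq> {} \<and> S \<subseteq> T}"
  have disj: "?I \<inter> block m = {}" by auto
  have finT: "finite T" using T by (rule block_finite)
  have finX: "finite ?X" by (rule finite_subset[of _ "Pow T"]) (use finT in auto)
  have "(\<Sum>B\<in>Pow (?I \<union> T). supp_gf False V B)
      = (\<Sum>B\<in>Pow ?I \<union> (\<lambda>S. ?I \<union> S) ` ?X. supp_gf False V B)"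
  proof (rule sum.mono_neutral_right)
    show "\<forall>B\<in>Pow (?I \<union> T) - (Pow ?I \<union> (\<lambda>S. ?I \<union> S) ` ?X). supp_gf False V B = 0"
    proof
      fix B
      assume B: "B \<in> Pow (?I \<union> T) - (Pow ?I \<union> (\<lambda>S. ?I \<union> S) ` ?X)"
      then obtain j where j: "j \<in> B" "j \<in> T" by blast
      have "prec i j" if "i \<in> ?I" for i
        using that j T by (auto simp: prec_def intro!: exI[of _ "m - 1"])
      then have "\<not> ideal B \<or> ?I \<subseteq> B" using j unfolding ideal_def by blast
      moreover have "\<not> ?I \<subseteq> B"
      proof
        assume "?I \<subseteq> B"
        then have "B = ?I \<union> (B \<inter> T)" using B by blast
        then show False using B j by blast
      qed
      ultimately show "supp_gf False V B = 0" using supp_gf_not_ideal by blast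
    qed
  qed (use finT in auto)
  also have "\<dots> = (\<Sum>B\<in>Pow ?I. supp_gf False V B) + (\<Sum>B\<in>(\<lambda>S. ?I \<union> S) ` ?X. supp_gf False V B)"
  proof (rule sum.union_disjoint)
    show "Pow ?I \<inter> (\<lambda>S. ?I \<union> S) ` ?X = {}" using disj T by blast
  qed (use finX in auto)
  also have "(\<Sum>B\<in>(\<lambda>S. ?I \<union> S) ` ?X. supp_gf False V B) = (\<Sum>S\<in>?X. supp_gf False V (?I \<union> S))"
  proof (subst sum.reindex)
    show "inj_on (\<lambda>S. ?I \<union> S) ?X"
      using inj_on_initial_Un by (rule inj_on_subset) (use T in auto)
  qed simp
  finally show ?thesis by (simp add: initial_gf_eq_sum)
qed

text \<open>Without \<open>D\<close> every smaller set may come next. The inhomogeneous term is thus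
  the whole of \<open>initial_gf V (m - 1)\<close>, where the strict case has the single support
  \<open>initial (m - 1)\<close>.\<close>

lemma weak_predecessors_sum:
  assumes m: "m \<ge> 1" and T: "T \<subseteq> block m" "T \<noteq> {}"
  shows "(\<Sum>B\<in>{B. B \<subset> initial (m - 1) \<union> T \<and> next_column False (initial (m - 1) \<union> T) B}.
      supp_gf False V B)
    = initial_gf V (m - 1) + (\<Sum>S\<in>{S. S \<noteq> {} \<and> S \<subset> T}. supp_gf False V (initial (m - 1) \<union> S))"
proof -
  let ?A = "initial (m - 1) \<union> T" and ?X = "{S. S \<noteq> {} \<and> S \<subset> T}"
  have finT: "finite T" using T(1) by (rule block_finite)
  have "Pow ?A = insert ?A {B. B \<subset> ?A \<and> next_column False ?A B}"
    by (auto simp: next_column_def)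
  moreover have "finite {B. B \<subset> ?A \<and> next_column False ?A B}"
    by (rule finite_subset[of _ "Pow ?A"]) (use finT in auto)
  ultimately have "(\<Sum>B\<in>Pow ?A. supp_gf False V B) = supp_gf False V ?A
      + (\<Sum>B\<in>{B. B \<subset> ?A \<and> next_column False ?A B}. supp_gf False V B)" by simp
  moreover have "{S. S \<noteq> {} \<and> S \<subseteq> T} = insert T ?X" using T(2) by auto
  moreover have "finite ?X" by (rule finite_subset[of _ "Pow T"]) (use finT in auto)
  ultimately show ?thesis using sum_Pow_initial_Un[OF m T(1), of V] by simp
qed

text \<open>A chain in block \<open>m\<close> either starts with the full block or stays below it,
  which gives the two summands of \<open>wvar V m (u m) + 1\<close>.\<close>

lemma initial_gf_prod:
  "initial_gf V k = (\<Prod>m\<in>{1..k}. (wvar V m (u m) + 1) * block_gf V m)"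
proof (induction k)
  case 0
  then show ?case using supp_gf_empty by (simp add: initial_gf_eq_sum)
next
  case (Suc k)
  define m where "m = Suc k"
  have m: "m \<ge> 1" by (simp add: m_def)
  let ?g = "\<lambda>S. supp_gf False V (initial (m - 1) \<union> S)" and ?h = "initial_gf V (m - 1)"
  let ?X = "{S. S \<noteq> {} \<and> S \<subset> block m}"
  have finX: "finite ?X" by (rule finite_subset[of _ "Pow (block m)"]) auto
  have rec: "?g S = wvar V m (card S) * (?h + (\<Sum>R\<in>{R. R \<noteq> {} \<and> R \<subset> S}. ?g R))"
    if "S \<subseteq> block m" "S \<noteq> {}" for S
    by (rule supp_gf_block_rec[OF m that, of False V, unfolded weak_predecessors_sum[OF m that]])
  have sol: "?h + (\<Sum>S\<in>?X. ?g S) = ?h * block_gf V m"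
    unfolding block_gf_def
    by (rule asc_sum_solve[OF _ block_nonempty[OF m]]) (use rec in auto)
  have "initial_gf V m = (\<Sum>B\<in>Pow (initial (m - 1) \<union> block m). supp_gf False V B)"
    unfolding initial_Un_block[OF m] by (rule initial_gf_eq_sum)
  also have "\<dots> = ?h + (\<Sum>S\<in>{S. S \<noteq> {} \<and> S \<subseteq> block m}. ?g S)"
    by (rule sum_Pow_initial_Un[OF m subset_refl])
  also have "{S. S \<noteq> {} \<and> S \<subseteq> block m} = insert (block m) ?X" using block_nonempty[OF m] by auto
  also have "?h + sum ?g (insert (block m) ?X) = ?g (block m) + (?h + sum ?g ?X)"
    using finX by (simp add: add_ac)
  also have "\<dots> = ?h * ((wvar V m (u m) + 1) * block_gf V m)"
    unfolding rec[OF subset_refl block_nonempty[OF m]] sol card_block[OF m] by (simp add: algebra_simps)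
  finally show ?case using Suc by (simp add: m_def)
qed

section \<open>Eulerian fractions and infinite products\<close>

text \<open>The last factor is set apart because the products in the Eulerian sums stop before
  \<open>u m\<close>.\<close>

lemma prod_block:
  assumes "m \<ge> 1"
  shows "(\<Prod>i\<in>{1..<u m}. f i) * f (u m) = (\<Prod>j\<in>block m. f (j - psum u (m - 1)))"
proof -
  have "(\<Prod>j\<in>block m. f (j - psum u (m - 1))) = (\<Prod>i\<in>{1..u m}. f i)"
    by (rule prod.reindex_bij_witness[where i = "\<lambda>i. psum u (m - 1) + i"
      and j = "\<lambda>j. j - psum u (m - 1)"])
      (use psum_pred[OF assms] in auto)
  also have "{1..u m} = insert (u m) {1..<u m}" using u_pos[OF assms] by auto
  finally show ?thesis by (simp add: mult.commute)
qed

lemma denom_block: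
  assumes "m \<ge> 1"
  shows "denom (psum u (m - 1) + 1) (psum u m) (qexp m)
    = (\<Prod>i\<in>{1..<u m}. 1 - yvar m i) * (1 - yvar m (u m))"
  unfolding prod_block[OF assms, of "\<lambda>i. 1 - yvar m i"] denom_def
  by (intro prod.cong refl) (auto simp: yvar_def yarg_def)

lemma denom_last:
  assumes "m \<ge> 1"
  shows "denom (psum u (m - 1) + 1) (psum u m - 1) (qexp m) = (\<Prod>i\<in>{1..<u m}. 1 - yvar m i)"
  unfolding denom_def
  by (rule prod.reindex_bij_witness[where i = "\<lambda>i. psum u (m - 1) + i"
      and j = "\<lambda>j. j - psum u (m - 1)"])
    (use psum_pred[OF assms] u_pos[OF assms] in \<open>auto simp: yvar_def yarg_def\<close>)

lemma block_gf_eulerian: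
  assumes "m \<ge> 1"
  shows "(\<Sum>\<sigma> | \<sigma> permutes {1..u m}. \<Prod>i\<in>{1..<u m}. yvar m i ^ of_bool (\<sigma> i > \<sigma> (i + 1)) + xvar V m i)
    = block_gf V m * (\<Prod>i\<in>{1..<u m}. 1 - yvar m i)"
proof -
  let ?a = "psum u (m - 1)"
  have "(\<Prod>i\<in>{1..<u m}. 1 - yvar m i) * asc_sum (wvar V m) {?a + 1..?a + u m}
      = (\<Sum>\<sigma> | \<sigma> permutes {1..u m}. \<Prod>i\<in>{1..<u m}. yvar m i ^ of_bool (\<sigma> i > \<sigma> (i + 1)) + xvar V m i)"
    by (rule asc_sum_eulerian) (rule wvar_mult wvar_mult')+
  then show ?thesis
    unfolding block_gf_def psum_pred[OF assms] by (subst mult.commute) (rule sym)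
qed

text \<open>The last arguments occur only in the prefactor, so all their specializations in the
  identities share this computation.\<close>

lemma eulerian_over_block:
  assumes "m \<ge> 1" and "\<And>i. i \<in> {1..<u m} \<Longrightarrow> x i = xarg u m (qexp m) i \<and> y i = yarg u m (qexp m) i"
  shows "eulerian_over (u m) x y
    = (y (u m) + x (u m)) * (block_gf True m * (\<Prod>i\<in>{1..<u m}. 1 - yvar m i))"
  unfolding eulerian_over_def block_gf_eulerian[OF assms(1), symmetric]
  by (intro arg_cong2[of _ _ _ _ "(*)"] refl sum.cong prod.cong) (simp_all add: assms(2) xvar_def yvar_def)

text \<open>With last argument 1 the prefactor is 1 + x = (1 - y)(w + 1), and 1 - y is the last
  factor of the denominator.\<close>

lemma over_block_eq:
  assumes "m \<ge> 1"
  shows "over_block u m (qexp m) = (wvar True m (u m) + 1) * block_gf True m"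
  unfolding over_block_def
proof (rule mps_divide_eqI[OF const_coeff_denom])
  have "eulerian_over (u m) (xarg u m (qexp m)) ((yarg u m (qexp m))(u m := 1))
      = (1 + xvar True m (u m)) * (block_gf True m * (\<Prod>i\<in>{1..<u m}. 1 - yvar m i))"
    by (subst eulerian_over_block[OF assms]) (auto simp: xvar_def)
  then show "eulerian_over (u m) (xarg u m (qexp m)) ((yarg u m (qexp m))(u m := 1))
      = (wvar True m (u m) + 1) * block_gf True m * denom (psum u (m - 1) + 1) (psum u m) (qexp m)"
    unfolding denom_block[OF assms] wvar_mult'[symmetric] by (simp only: mult_ac)
qed

text \<open>Since x = 0, the prefactor that \<open>eulerian\<close> lacks can be written as 1 + x,
  which reduces this to the previous computation.\<close>

lemma plain_block_eq:
  assumes "m \<ge> 1"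
  shows "plain_block u m (qexp m) = (wvar False m (u m) + 1) * block_gf False m"
  unfolding plain_block_def
proof (rule mps_divide_eqI[OF const_coeff_denom])
  have "eulerian (u m) (yarg u m (qexp m))
      = (1 + xvar False m (u m)) * (block_gf False m * (\<Prod>i\<in>{1..<u m}. 1 - yvar m i))"
    unfolding eulerian_def block_gf_eulerian[OF assms, symmetric] by (simp add: xvar_def yvar_def)
  then show "eulerian (u m) (yarg u m (qexp m))
      = (wvar False m (u m) + 1) * block_gf False m * denom (psum u (m - 1) + 1) (psum u m) (qexp m)"
    unfolding denom_block[OF assms] wvar_mult'[symmetric] by (simp only: mult_ac)
qed

lemma strict_block_eq:
  assumes "m \<ge> 1"
  shows "strict_block u m (qexp m) = strict_block_gf True m"
  unfolding strict_block_def
proof (rule mps_divide_eqI[OF const_coeff_denom])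
  have "eulerian_over (u m) (xarg u m (qexp m)) (yarg u m (qexp m))
      = (yvar m (u m) + xvar True m (u m)) * (block_gf True m * (\<Prod>i\<in>{1..<u m}. 1 - yvar m i))"
    by (subst eulerian_over_block[OF assms]) (auto simp: xvar_def yvar_def)
  then show "eulerian_over (u m) (xarg u m (qexp m)) (yarg u m (qexp m))
      = strict_block_gf True m * denom (psum u (m - 1) + 1) (psum u m) (qexp m)"
    unfolding denom_block[OF assms] wvar_mult[symmetric] strict_block_gf_def by (simp only: mult_ac)
qed

text \<open>The arguments 0 and 1 turn the prefactor into 1, and the denominator stops before U_m,
  so no trace of the full block remains.\<close>

lemma strict_last_eq:
  assumes "m \<ge> 1"
  shows "strict_last u m (qexp m) = block_gf True m"
  unfolding strict_last_def
proof (rule mps_divide_eqI[OF const_coeff_denom])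
  show "eulerian_over (u m) ((xarg u m (qexp m))(u m := 0)) ((yarg u m (qexp m))(u m := 1))
      = block_gf True m * denom (psum u (m - 1) + 1) (psum u m - 1) (qexp m)"
    unfolding denom_last[OF assms] by (subst eulerian_over_block[OF assms]) auto
qed

text \<open>For a one-element block the Eulerian sum is a single empty product, and
  \<open>qexp\<close> at n_i is i. The heads are thus ordinary block fractions.\<close>

lemma head_eqs:
  assumes "n i = enat m" "i \<ge> 1"
  shows "over_head u n i = over_block u m (qexp m)"
    and "plain_head u n i = plain_block u m (qexp m)"
    and "strict_head u n i = strict_block u m (qexp m)"
proof -
  have um: "u m = 1" and e: "qexp m = i" using u_n qexp_head assms by blast+
  have "m \<ge> 1" using n_ge[of i] assms by simp
  then have p: "psum u m = Suc (psum u (m - 1))" using psum_pred um by simp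
  have perms: "{\<sigma>. \<sigma> permutes {Suc 0..Suc 0}} = {id}" by auto
  show "over_head u n i = over_block u m (qexp m)"
    and "plain_head u n i = plain_block u m (qexp m)"
    and "strict_head u n i = strict_block u m (qexp m)"
    unfolding over_head_def plain_head_def strict_head_def over_block_def plain_block_def
      strict_block_def eulerian_over_def eulerian_def denom_def xarg_def yarg_def
    by (simp_all add: assms um e p perms distrib_right)
qed

text \<open>In a gap the exponents agree. At k = n_i they are i - 1 and i, but a one-element block
  leaves no indeterminate in the fraction.\<close>

lemma strict_last_exponent:
  assumes "i \<ge> 1" "k \<in> last_blocks n i"
  shows "strict_last u k (i - 1) = strict_last u k (qexp k)"
proof (cases "n i = enat k")
  case True
  then have um: "u k = 1" using u_n assms(1) by blast
  have "k \<ge> 1" using n_ge[of i] assms True by simp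
  then have p: "psum u k = Suc (psum u (k - 1))" using psum_pred um by simp
  show ?thesis
    unfolding strict_last_def eulerian_over_def denom_def by (simp add: um p)
next
  case False
  then have "k \<in> gap n i" using assms(2) by (auto simp: last_blocks_def gap_def)
  then show ?thesis using qexp_gap assms(1) by simp
qed

section \<open>Constant coefficients and regrouping of the product over blocks\<close>

lemma const_coeff_wvar: "mps_coeff (wvar V m i) {#} = 0"
  by (simp add: wvar_def const_coeff_mult plus_mps.rep_eq yvar_def yarg_def xvar_def
      xarg_def mps_var.rep_eq zero_mps.rep_eq)

lemma const_coeff_block_gf:
  assumes "m \<ge> 1"
  shows "mps_coeff (block_gf V m) {#} = 1"
  unfolding block_gf_def asc_sum_rec[OF finite_atLeastAtMost block_nonempty[OF assms]]
  by (simp add: plus_mps.rep_eq one_mps.rep_eq mps_coeff_sum const_coeff_mult const_coeff_wvar)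

lemma const_coeff_block_factor:
  "m \<ge> 1 \<Longrightarrow> mps_coeff ((wvar V m (u m) + 1) * block_gf V m) {#} = 1"
  by (simp add: const_coeff_mult plus_mps.rep_eq one_mps.rep_eq const_coeff_block_gf const_coeff_wvar)

lemma gap_finite:
  assumes "n (i - 1) = enat a" "n i = enat b"
  shows "gap n i = {a<..<b}"
  using assms by (auto simp: gap_def)

lemma gap_infinity: "n (i - 1) = \<infinity> \<Longrightarrow> gap n i = {}"
  by (simp add: gap_def)

lemma gap_ge_1: "m \<in> gap n i \<Longrightarrow> m \<ge> 1"
  by (cases m) (auto simp: gap_def zero_enat_def[symmetric])

definition gap_factor :: "(nat \<Rightarrow> indet mps) \<Rightarrow> nat \<Rightarrow> nat \<Rightarrow> indet mps" where
  "gap_factor F i m = (if m \<in> gap n i then F m else 1)"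

context
  fixes F :: "nat \<Rightarrow> indet mps" and h :: "nat \<Rightarrow> indet mps"
  assumes h: "\<And>i m. i \<ge> 1 \<Longrightarrow> n i = enat m \<Longrightarrow> h i = F m"
begin

text \<open>The blocks after a = n_{i-1} up to b = n_i are those of the gap together with
  \<open>b\<close>, whose fraction is the head \<open>h i\<close>.\<close>

lemma prod_grouped_step:
  fixes a b :: nat
  assumes "n (i - 1) = enat a" "n i = enat b" "i \<ge> 1"
  shows "(\<Prod>m\<in>{1..a}. F m) * (h i * (\<Prod>m\<in>gap n i. F m)) = (\<Prod>m\<in>{1..b}. F m)"
proof -
  have "a < b" using n_less[of "i - 1" i] assms by simp
  then have "{1..b} = insert b ({1..a} \<union> {a<..<b})" by auto
  moreover have "(\<Prod>m\<in>{1..a} \<union> {a<..<b}. F m) = (\<Prod>m\<in>{1..a}. F m) * (\<Prod>m\<in>{a<..<b}. F m)"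
    by (rule prod.union_disjoint) auto
  ultimately show ?thesis
    using \<open>a < b\<close> by (simp add: gap_finite[OF assms(1,2)] h[OF assms(3,2)] mult_ac)
qed

lemma prod_grouped:
  "n i = enat a \<Longrightarrow> (\<Prod>j\<in>{1..i}. h j * (\<Prod>m\<in>gap n j. F m)) = (\<Prod>m\<in>{1..a}. F m)"
proof (induction i arbitrary: a)
  case 0
  then show ?case by (simp add: n_0 zero_enat_def)
next
  case (Suc i)
  then obtain b where b: "n i = enat b" using n_Suc[of i] by (cases "n i") auto
  have "(\<Prod>j\<in>{1..Suc i}. h j * (\<Prod>m\<in>gap n j. F m))
      = (\<Prod>m\<in>{1..b}. F m) * (h (Suc i) * (\<Prod>m\<in>gap n (Suc i). F m))"
    using Suc.IH[OF b] by simp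
  then show ?case using prod_grouped_step[of "Suc i" b a] b Suc.prems by simp
qed

context
  fixes Z :: "indet mps"
  assumes F: "\<And>m. m \<ge> 1 \<Longrightarrow> mps_coeff (F m) {#} = 1"
    and h_inf: "\<And>i. n i = \<infinity> \<Longrightarrow> h i = 1"
    and lim: "(\<lambda>N. \<Prod>m\<in>{1..N}. F m) \<longlonglongrightarrow> Z"
begin

lemma const_coeff_gap_factor: "mps_coeff (gap_factor F i m) {#} = 1"
  using F gap_ge_1 by (auto simp: gap_factor_def one_mps.rep_eq)

lemma prod_gap_factor: "(\<Prod>m\<le>N. gap_factor F i m) = (\<Prod>m\<in>{..N} \<inter> gap n i. F m)"
  unfolding gap_factor_def by (simp add: prod.inter_restrict)

lemma prodinf_gap_factor_finite:
  assumes "finite (gap n i)"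
  shows "convergent_prod (gap_factor F i)" "prodinf (gap_factor F i) = (\<Prod>m\<in>gap n i. F m)"
proof -
  obtain K where K: "gap n i \<subseteq> {..K}" using assms finite_nat_iff_bounded_le by blast
  have "\<forall>\<^sub>F N in sequentially. (\<Prod>m\<le>N. gap_factor F i m) = (\<Prod>m\<in>gap n i. F m)"
    unfolding eventually_sequentially
  proof (intro exI[of _ K] allI impI)
    fix N
    assume "K \<le> N"
    then have "{..N} \<inter> gap n i = gap n i" using K by auto
    then show "(\<Prod>m\<le>N. gap_factor F i m) = (\<Prod>m\<in>gap n i. F m)" by (simp add: prod_gap_factor)
  qed
  then have "(\<lambda>N. \<Prod>m\<le>N. gap_factor F i m) \<longlonglongrightarrow> (\<Prod>m\<in>gap n i. F m)" by (rule tendsto_eventually)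
  from mps_prodinf[OF const_coeff_gap_factor this]
  show "convergent_prod (gap_factor F i)" "prodinf (gap_factor F i) = (\<Prod>m\<in>gap n i. F m)" .
qed

text \<open>An infinite gap occurs only after the last finite n_i. Its product is the limit
  \<open>Z\<close> divided by the product of the blocks before, which is invertible since its
  constant coefficient is 1.\<close>

lemma prodinf_gap_factor_infinite:
  fixes a :: nat
  assumes "n (i - 1) = enat a" "n i = \<infinity>"
  shows "convergent_prod (gap_factor F i)" "(\<Prod>m\<in>{1..a}. F m) * prodinf (gap_factor F i) = Z"
proof -
  let ?P = "\<Prod>m\<in>{1..a}. F m"
  have P: "?P * inverse ?P = 1" by (rule mps_right_inverse) (simp add: const_coeff_prod F)
  have gap: "gap n i = {a<..}" using assms by (auto simp: gap_def)
  have "\<forall>\<^sub>F N in sequentially. inverse ?P * (\<Prod>m\<in>{1..N}. F m) = (\<Prod>m\<le>N. gap_factor F i m)"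
    unfolding eventually_sequentially
  proof (intro exI[of _ a] allI impI)
    fix N
    assume "a \<le> N"
    then have "{1..N} = {1..a} \<union> {a<..N}" by auto
    then have "(\<Prod>m\<in>{1..N}. F m) = ?P * (\<Prod>m\<in>{a<..N}. F m)"
      by (simp only:) (rule prod.union_disjoint, auto)
    then have "inverse ?P * (\<Prod>m\<in>{1..N}. F m) = ?P * inverse ?P * (\<Prod>m\<in>{a<..N}. F m)"
      by (simp only: mult_ac)
    moreover have "{..N} \<inter> gap n i = {a<..N}" unfolding gap by auto
    ultimately show "inverse ?P * (\<Prod>m\<in>{1..N}. F m) = (\<Prod>m\<le>N. gap_factor F i m)"
      by (simp only: P mult_1 prod_gap_factor)
  qed
  then have "(\<lambda>N. \<Prod>m\<le>N. gap_factor F i m) \<longlonglongrightarrow> inverse ?P * Z"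
    by (rule Lim_transform_eventually[OF tendsto_mps_mult_left[OF lim]])
  from mps_prodinf[OF const_coeff_gap_factor this]
  show "convergent_prod (gap_factor F i)" "?P * prodinf (gap_factor F i) = Z"
    using P by (simp_all flip: mult.assoc)
qed

lemma convergent_prod_gap_factor:
  assumes "i \<ge> 1"
  shows "convergent_prod (gap_factor F i)"
proof (cases "n (i - 1)")
  case infinity
  then show ?thesis using prodinf_gap_factor_finite(1) by (simp add: gap_infinity)
next
  case (enat a)
  then show ?thesis
    using prodinf_gap_factor_infinite(1) prodinf_gap_factor_finite(1) gap_finite
    by (cases "n i") auto
qed

text \<open>The product telescopes: \<open>P k\<close> is the product over the first
  \<open>k\<close> blocks, read as \<open>Z\<close> at infinity, and \<open>f (Suc i)\<close>
  carries \<open>P (n i)\<close> to \<open>P (n (Suc i))\<close>.\<close>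

lemma prodinf_grouped:
  shows "convergent_prod (\<lambda>i. h (Suc i) * prodinf (gap_factor F (Suc i)))"
    and "(\<Prod>i. h (Suc i) * prodinf (gap_factor F (Suc i))) = Z"
proof -
  define f where "f i = h i * prodinf (gap_factor F i)" for i
  define P where "P k = (case k of enat a \<Rightarrow> \<Prod>m\<in>{1..a}. F m | \<infinity> \<Rightarrow> Z)" for k
  have step: "P (n i) * f (Suc i) = P (n (Suc i))" for i
  proof (cases "n i")
    case infinity
    then have inf: "n (Suc i) = \<infinity>" using n_Suc[of i] by auto
    have "gap n (Suc i) = {}" using infinity by (intro gap_infinity) simp
    then have "f (Suc i) = 1"
      using prodinf_gap_factor_finite(2)[of "Suc i"] h_inf[OF inf] by (simp add: f_def)
    then show ?thesis using infinity inf by simp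
  next
    case (enat a)
    show ?thesis
    proof (cases "n (Suc i)")
      case (enat b)
      have "finite (gap n (Suc i))" using gap_finite[of "Suc i"] \<open>n i = enat a\<close> enat by simp
      then show ?thesis
        using prod_grouped_step[of "Suc i" a b] \<open>n i = enat a\<close> enat
        by (simp add: P_def f_def prodinf_gap_factor_finite(2))
    next
      case infinity
      then show ?thesis
        using prodinf_gap_factor_infinite(2)[of "Suc i" a] \<open>n i = enat a\<close> h_inf[OF infinity]
        by (simp add: P_def f_def)
    qed
  qed
  have partial: "(\<Prod>i\<le>N. f (Suc i)) = P (n (Suc N))" for N
  proof (induction N)
    case 0
    show ?case using step[of 0] by (simp add: n_0 P_def zero_enat_def)
  next
    case (Suc N)
    then show ?case using step[of "Suc N"] by simp
  qed
  have lim': "(\<lambda>N. P (n (Suc N))) \<longlonglongrightarrow> Z"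
  proof (cases "\<exists>N. n N = \<infinity>")
    case True
    then obtain K where K: "n K = \<infinity>" by blast
    have "\<forall>\<^sub>F N in sequentially. P (n (Suc N)) = Z"
      unfolding eventually_sequentially
    proof (intro exI[of _ K] allI impI)
      fix N
      assume "K \<le> N"
      then have "n K \<le> n (Suc N)" by (intro n_mono) simp
      then have "n (Suc N) = \<infinity>" using K by simp
      then show "P (n (Suc N)) = Z" by (simp add: P_def)
    qed
    then show ?thesis by (rule tendsto_eventually)
  next
    case False
    \<comment> \<open>If all n_i are finite, the grouped partial products form a subsequence of the
      products over blocks.\<close>
    define g where "g N = the_enat (n (Suc N))" for N
    have g: "n (Suc N) = enat (g N)" for N     proof -
      have "n (Suc N) \<noteq> \<infinity>"
      proof
        assume "n (Suc N) = \<infinity>"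
        then have "\<exists>N. n N = \<infinity>" by (rule exI)
        with False show False by contradiction
      qed
      then show ?thesis by (cases "n (Suc N)") (auto simp: g_def)
    qed
    have "N \<le> g N" for N using n_ge[of "Suc N"] g[of N] by simp
    then have "filterlim g at_top sequentially"
      by (intro filterlim_at_top_mono[OF filterlim_ident]) simp
    from filterlim_compose[OF lim this] show ?thesis by (simp add: g P_def)
  qed
  \<comment> \<open>The constant coefficient of a possibly infinite gap product is read off from
    \<open>step\<close>, as both values of \<open>P\<close> have constant coefficient 1.\<close>
  have "mps_coeff (f (Suc i)) {#} = 1" for i
  proof -
    have P1: "mps_coeff (P (n i)) {#} = 1" for i
    proof (cases "n i")
      case (enat a)
      then show ?thesis by (simp add: P_def const_coeff_prod F)
    next
      case infinity
      have "\<forall>\<^sub>F N in sequentially. mps_coeff (\<Prod>m\<in>{1..N}. F m) {#} = mps_coeff Z {#}"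
        using lim by (simp add: tendsto_mps_iff)
      then show ?thesis using infinity by (simp add: P_def const_coeff_prod F)
    qed
    show ?thesis
      using arg_cong[OF step[of i], of "\<lambda>f. mps_coeff f {#}"] by (simp add: const_coeff_mult P1)
  qed
  moreover have "(\<lambda>N. \<Prod>i\<le>N. f (Suc i)) \<longlonglongrightarrow> Z" using lim' by (simp only: partial)
  ultimately show "convergent_prod (\<lambda>i. h (Suc i) * prodinf (gap_factor F (Suc i)))"
    and "(\<Prod>i. h (Suc i) * prodinf (gap_factor F (Suc i))) = Z"
    using mps_prodinf[of "\<lambda>i. f (Suc i)" Z] unfolding f_def by blast+
qed

end

end

section \<open>Passage to the infinite sums\<close>

lemma gf_term_has_sum:
  assumes "L \<subseteq> admissible D V"
  shows "(gf_term u n has_sum gf L) L"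
  using mgf_has_sum[OF fin_fibres_subset[OF fin_fibres_admissible assms], of "sseq u n"]
  unfolding gf_def gf_term_eq_mon .

lemma gf_UN_has_sum:
  assumes "(\<Union>i\<in>I. L i) \<subseteq> admissible D V" "disjoint_family_on L I"
  shows "((\<lambda>i. gf (L i)) has_sum gf (\<Union>i\<in>I. L i)) I"
  unfolding gf_def
  by (rule mgf_UN_has_sum[OF fin_fibres_subset[OF fin_fibres_admissible assms(1)] assms(2)])

text \<open>A finite support lies in all sufficiently large initial sets, because
  \<open>k \<le> psum u k\<close>.\<close>

lemma block_prod_tendsto:
  "(\<lambda>N. \<Prod>m\<in>{1..N}. (wvar V m (u m) + 1) * block_gf V m) \<longlonglongrightarrow> gf (admissible False V)"
  unfolding initial_gf_prod[symmetric] initial_gf_def gf_def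
proof (rule mgf_tendsto[OF fin_fibres_admissible])
  fix l
  assume l: "l \<in> admissible False V"
  obtain K where K: "supp l \<subseteq> {..K}" using supp_admissible(1)[OF l] finite_nat_iff_bounded_le by blast
  have "l \<in> {l \<in> admissible False V. supp l \<subseteq> initial k}" if "k \<ge> K" for k
  proof -
    have "i \<in> initial k" if "i \<in> supp l" for i
    proof -
      have "i \<noteq> 0" using that supp_admissible(2)[OF l] by metis
      moreover have "i \<le> psum u k"
        using that K \<open>k \<ge> K\<close> psum_ge[of k] by (meson atMost_iff order_trans subsetD)
      ultimately show ?thesis by simp
    qed
    then show ?thesis using l by blast
  qed
  then show "\<forall>\<^sub>F k in sequentially. l \<in> {l \<in> admissible False V. supp l \<subseteq> initial k}"
    unfolding eventually_sequentially by blast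
qed auto

text \<open>A common form of the first two identities: \<open>F\<close> is the block fraction as a
  function of block and exponent, \<open>h\<close> the head. In the gap before n_i the exponent i -
  1 is \<open>qexp m\<close>.\<close>

lemma weak_identity:
  fixes F :: "nat \<Rightarrow> nat \<Rightarrow> indet mps"
  assumes F: "\<And>m. m \<ge> 1 \<Longrightarrow> F m (qexp m) = (wvar V m (u m) + 1) * block_gf V m"
    and h: "\<And>i m. i \<ge> 1 \<Longrightarrow> n i = enat m \<Longrightarrow> h i = F m (qexp m)"
    and h_inf: "\<And>i. n i = \<infinity> \<Longrightarrow> h i = 1"
    and f: "\<And>i. f i = h i * (\<Prod>m. if m \<in> gap n i then F m (i - 1) else 1)"
  shows "gf_term u n summable_on admissible False V \<and>
      (\<forall>i\<ge>1. convergent_prod (\<lambda>m. if m \<in> gap n i then F m (i - 1) else 1)) \<and>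
      convergent_prod (\<lambda>i. f (Suc i)) \<and>
      (\<Sum>\<^sub>\<infinity>l\<in>admissible False V. gf_term u n l) = (\<Prod>i. f (Suc i))"
proof -
  let ?F = "\<lambda>m. F m (qexp m)"
  have const: "mps_coeff (?F m) {#} = 1" if "m \<ge> 1" for m
    using const_coeff_block_factor that by (simp add: F)
  have lim: "(\<lambda>N. \<Prod>m\<in>{1..N}. ?F m) \<longlonglongrightarrow> gf (admissible False V)"
  proof -
    have "(\<Prod>m\<in>{1..N}. ?F m) = (\<Prod>m\<in>{1..N}. (wvar V m (u m) + 1) * block_gf V m)" for N
      using F by (intro prod.cong) simp_all
    then show ?thesis using block_prod_tendsto[of V] by (simp only:)
  qed
  have gap: "(\<lambda>m. if m \<in> gap n i then F m (i - 1) else 1) = gap_factor ?F i" if "i \<ge> 1" for i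
    using qexp_gap[OF that] by (auto simp: gap_factor_def)
  have "f (Suc i) = h (Suc i) * prodinf (gap_factor ?F (Suc i))" for i
    using gap[of "Suc i"] by (simp add: f)
  moreover note prodinf_grouped[of h ?F, OF h const h_inf lim]
  moreover have "convergent_prod (gap_factor ?F i)" if "i \<ge> 1" for i
    using convergent_prod_gap_factor[of h ?F, OF h const h_inf lim] that by blast
  moreover have "(gf_term u n has_sum gf (admissible False V)) (admissible False V)"
    by (rule gf_term_has_sum[OF subset_refl])
  ultimately show ?thesis
    using gap by (auto simp: infsumI intro: has_sum_imp_summable)
qed

section \<open>Strict sequences sorted by the first block with a missing element\<close>

definition first_gap :: "nat \<Rightarrow> (nat \<Rightarrow> part) set" where
  "first_gap k = {l \<in> admissible True True. initial (k - 1) \<subseteq> supp l \<and> supp l \<subset> initial k}"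

lemma first_gap_disjoint:
  assumes "j < k"
  shows "first_gap j \<inter> first_gap k = {}"
proof -
  have "psum u j \<le> psum u (k - 1)" using assms by simp
  then have "initial j \<subseteq> initial (k - 1)" by auto
  then show ?thesis unfolding first_gap_def by blast
qed

text \<open>The least \<open>k\<close> whose initial set properly contains the support works: by
  minimality the support equals the previous initial set or reaches beyond it, and in the latter
  case the ideal property fills that set.\<close>

lemma ex_first_gap:
  assumes l: "l \<in> admissible True True"
  obtains k where "k \<ge> 1" "l \<in> first_gap k"
proof -
  obtain K where K: "supp l \<subseteq> {..K}" using supp_admissible(1)[OF l] finite_nat_iff_bounded_le by blast
  define k where "k = (LEAST k. supp l \<subset> initial k)"
  \<comment> \<open>The successor makes the inclusion proper, since \<open>Suc K\<close> exceeds
    every element of the support.\<close>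
  have "supp l \<subset> initial (Suc K)"
  proof
    show "supp l \<subseteq> initial (Suc K)"
    proof
      fix i
      assume i: "i \<in> supp l"
      then have "i \<noteq> 0" using supp_admissible(2)[OF l] by metis
      moreover have "i \<le> K" using i K by auto
      ultimately show "i \<in> initial (Suc K)" using psum_ge[of "Suc K"] by simp
    qed
    have "Suc K \<in> initial (Suc K)" "Suc K \<notin> supp l" using psum_ge[of "Suc K"] K by auto
    then show "supp l \<noteq> initial (Suc K)" by blast
  qed
  then have k: "supp l \<subset> initial k" unfolding k_def by (rule LeastI)
  then have "k \<ge> 1" by (cases k) auto
  then have "\<not> supp l \<subset> initial (k - 1)"
    using not_less_Least[of "k - 1" "\<lambda>k. supp l \<subset> initial k"] by (simp add: k_def)
  then consider "supp l = initial (k - 1)" | j where "j \<in> supp l" "j \<notin> initial (k - 1)" by blast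
  then have "initial (k - 1) \<subseteq> supp l"
  proof cases
    case 2
    then have "j \<noteq> 0" using supp_admissible(2)[OF l] by metis
    then have "prec i j" if "i \<in> initial (k - 1)" for i
      using that 2(2) by (auto simp: prec_def intro!: exI[of _ "k - 1"])
    then show ?thesis using supp_admissible(3)[OF l] 2(1) unfolding ideal_def by blast
  qed simp
  then show ?thesis using that \<open>k \<ge> 1\<close> k l by (simp add: first_gap_def)
qed

text \<open>Heads and gaps before i give the blocks up to a = n_{i-1}, and the middle product gives
  those between \<open>a\<close> and \<open>k\<close>; together they are the complete blocks before
  the incomplete block \<open>k\<close>.\<close>

lemma strict_term_eq:
  assumes i: "i \<ge> 1" and k: "k \<in> last_blocks n i"
  shows "strict_term u n i k = gf (first_gap k)"
proof -
  obtain a where a: "n (i - 1) = enat a" "a < k" using k by (cases "n (i - 1)") (auto simp: last_blocks_def)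
  let ?F = "strict_block_gf True"
  have F: "strict_block u m (j - 1) = ?F m" if "j \<ge> 1" "m \<in> gap n j" for j m
    using qexp_gap[OF that] strict_block_eq[OF gap_ge_1[OF that(2)]] by simp
  have head: "strict_head u n j = ?F m" if "j \<ge> 1" "n j = enat m" for j m
  proof -
    have "m \<ge> 1" using n_ge[of j] that by simp
    then show ?thesis using head_eqs(3)[OF that(2,1)] strict_block_eq by simp
  qed
  have 1: "strict_last u k (i - 1) = block_gf True k"
    unfolding strict_last_exponent[OF i k] using a(2) by (intro strict_last_eq) simp
  have gap: "m \<in> gap n i" if "m \<in> {a<..<k}" for m
  proof -
    have "enat m < enat k" using that by simp
    also have "\<dots> \<le> n i" using k by (simp add: last_blocks_def)
    finally show ?thesis using that unfolding gap_def a(1) by simp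
  qed
  have "{m. n (i - 1) < enat m \<and> m < k} = {a<..<k}" unfolding a(1) by auto
  then have 2: "(\<Prod>m | n (i - 1) < enat m \<and> m < k. strict_block u m (i - 1)) = (\<Prod>m\<in>{a<..<k}. ?F m)"
    using F[OF i gap] by (intro prod.cong)
  have 3: "(\<Prod>j\<in>{1..<i}. strict_head u n j * (\<Prod>m\<in>gap n j. strict_block u m (j - 1)))
      = (\<Prod>m\<in>{1..a}. ?F m)"
  proof -
    have "{1..<i} = {1..i - 1}" using i by auto
    then have "(\<Prod>j\<in>{1..<i}. strict_head u n j * (\<Prod>m\<in>gap n j. strict_block u m (j - 1)))
        = (\<Prod>j\<in>{1..i - 1}. strict_head u n j * (\<Prod>m\<in>gap n j. ?F m))"
      using F by (intro prod.cong arg_cong2[of _ _ _ _ "(*)"]) auto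
    also have "\<dots> = (\<Prod>m\<in>{1..a}. ?F m)" using head by (rule prod_grouped) (use a in auto)
    finally show ?thesis .
  qed
  have "{1..k - 1} = {1..a} \<union> {a<..<k}" using a(2) by auto
  then have "(\<Prod>m\<in>{1..k - 1}. ?F m) = (\<Prod>m\<in>{1..a}. ?F m) * (\<Prod>m\<in>{a<..<k}. ?F m)"
    by (simp only:) (rule prod.union_disjoint, auto)
  then have "gf (first_gap k) = (\<Prod>m\<in>{1..a}. ?F m) * (\<Prod>m\<in>{a<..<k}. ?F m) * block_gf True k"
    unfolding first_gap_def using gf_strict_first_zero[of k True] a(2) by simp
  then show ?thesis unfolding strict_term_def 1 2 3 by (simp only: mult_ac)
qed

text \<open>The half-open intervals from n_{i-1} to n_i cover the positive integers, because n_i is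
  at least i.\<close>

lemma ex_last_blocks:
  assumes "k \<ge> 1"
  obtains i where "i \<ge> 1" "k \<in> last_blocks n i"
proof -
  define i where "i = (LEAST i. enat k \<le> n i)"
  have le: "enat k \<le> n i" unfolding i_def by (rule LeastI[of _ k]) (rule n_ge)
  then have "i \<ge> 1" using assms n_0 by (cases i) (auto simp: zero_enat_def)
  moreover have "\<not> enat k \<le> n (i - 1)"
    using not_less_Least[of "i - 1" "\<lambda>i. enat k \<le> n i"] \<open>i \<ge> 1\<close> by (simp add: i_def)
  ultimately show ?thesis using that le by (auto simp: last_blocks_def)
qed

lemma last_blocks_disjoint:
  assumes "i < j"
  shows "last_blocks n i \<inter> last_blocks n j = {}"
proof -
  have "n i \<le> n (j - 1)" using assms by (intro n_mono) simp
  then show ?thesis by (auto simp: last_blocks_def dest: order_trans leD)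
qed

text \<open>The sequences are grouped by the incomplete block \<open>k\<close>, and these blocks by
  i. Both levels are disjoint unions, which yields the inner and the outer summability along with
  the values.\<close>

lemma strict_identity:
  "gf_term u n summable_on admissible True True \<and>
      (\<forall>i\<ge>1. strict_term u n i summable_on last_blocks n i) \<and>
      (\<lambda>i. \<Sum>\<^sub>\<infinity>k\<in>last_blocks n i. strict_term u n i k) summable_on {1..} \<and>
      (\<Sum>\<^sub>\<infinity>l\<in>admissible True True. gf_term u n l)
        = (\<Sum>\<^sub>\<infinity>i\<in>{1..}. \<Sum>\<^sub>\<infinity>k\<in>last_blocks n i. strict_term u n i k)"
proof -
  define L where "L i = (\<Union>k\<in>last_blocks n i. first_gap k)" for i
  have disj: "j = k" if "l \<in> first_gap j" "l \<in> first_gap k" for j k l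
    using first_gap_disjoint[of j k] first_gap_disjoint[of k j] that by (cases j k rule: linorder_cases) auto
  have disj': "i = j" if "k \<in> last_blocks n i" "k \<in> last_blocks n j" for i j k
    using last_blocks_disjoint[of i j] last_blocks_disjoint[of j i] that by (cases i j rule: linorder_cases) auto
  have inner: "(strict_term u n i has_sum gf (L i)) (last_blocks n i)" if "i \<ge> 1" for i
  proof -
    have "((\<lambda>k. gf (first_gap k)) has_sum gf (L i)) (last_blocks n i)"
      unfolding L_def
    proof (rule gf_UN_has_sum[of _ _ True True])
      show "disjoint_family_on first_gap (last_blocks n i)"
        unfolding disjoint_family_on_def using disj by blast
    qed (auto simp: first_gap_def)
    then show ?thesis using strict_term_eq[OF that] by (simp cong: has_sum_cong)
  qed
  then have infsum: "(\<Sum>\<^sub>\<infinity>k\<in>last_blocks n i. strict_term u n i k) = gf (L i)" if "i \<ge> 1" for i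
    using that infsumI by blast
  have all: "admissible True True = (\<Union>i\<in>{1..}. L i)"
  proof (intro equalityI subsetI)
    fix l
    assume "l \<in> admissible True True"
    then obtain k where k: "k \<ge> 1" "l \<in> first_gap k" by (rule ex_first_gap)
    from k(1) obtain i where "i \<ge> 1" "k \<in> last_blocks n i" by (rule ex_last_blocks)
    then show "l \<in> (\<Union>i\<in>{1..}. L i)" using k(2) by (auto simp: L_def)
  qed (auto simp: L_def first_gap_def)
  have "((\<lambda>i. gf (L i)) has_sum gf (\<Union>i\<in>{1..}. L i)) {1..}"
  proof (rule gf_UN_has_sum[of _ _ True True])
    show "disjoint_family_on L {1..}"
      using disj disj' unfolding disjoint_family_on_def L_def by blast
  qed (auto simp: L_def first_gap_def)
  moreover have "((\<lambda>i. \<Sum>\<^sub>\<infinity>k\<in>last_blocks n i. strict_term u n i k) has_sum S) {1..}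
      \<longleftrightarrow> ((\<lambda>i. gf (L i)) has_sum S) {1..}" for S
    by (rule has_sum_cong) (use infsum in auto)
  ultimately have outer: "((\<lambda>i. \<Sum>\<^sub>\<infinity>k\<in>last_blocks n i. strict_term u n i k)
      has_sum gf (admissible True True)) {1..}"
    unfolding all by blast
  have "(gf_term u n has_sum gf (admissible True True)) (admissible True True)"
    by (rule gf_term_has_sum[OF subset_refl])
  then show ?thesis
    using inner outer by (auto simp: infsumI intro: has_sum_imp_summable)
qed

end

theorem theorem1p24:
  fixes u :: "nat \<Rightarrow> nat" and n :: "nat \<Rightarrow> enat"
  assumes u_pos: "\<And>m. m \<ge> 1 \<Longrightarrow> u m \<ge> 1"
    and n_incr: "increasing_seq n"
    and u_n: "\<And>i m. i \<ge> 1 \<Longrightarrow> n i = enat m \<Longrightarrow> u m = 1"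
  shows
    "(gf_term u n summable_on block_overpartitions u \<and>
      (\<forall>i\<ge>1. convergent_prod (\<lambda>m. if m \<in> gap n i then over_block u m (i - 1) else 1)) \<and>
      convergent_prod (\<lambda>i. over_factor u n (Suc i)) \<and>
      (\<Sum>\<^sub>\<infinity>l\<in>block_overpartitions u. gf_term u n l) = (\<Prod>i. over_factor u n (Suc i))) \<and>
     (gf_term u n summable_on block_partitions u \<and>
      (\<forall>i\<ge>1. convergent_prod (\<lambda>m. if m \<in> gap n i then plain_block u m (i - 1) else 1)) \<and>
      convergent_prod (\<lambda>i. plain_factor u n (Suc i)) \<and>
      (\<Sum>\<^sub>\<infinity>l\<in>block_partitions u. gf_term u n l) = (\<Prod>i. plain_factor u n (Suc i))) \<and>
     (gf_term u n summable_on block_strict_overpartitions u \<and>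
      (\<forall>i\<ge>1. strict_term u n i summable_on last_blocks n i) \<and>
      (\<lambda>i. \<Sum>\<^sub>\<infinity>k\<in>last_blocks n i. strict_term u n i k) summable_on {1..} \<and>
      (\<Sum>\<^sub>\<infinity>l\<in>block_strict_overpartitions u. gf_term u n l)
        = (\<Sum>\<^sub>\<infinity>i\<in>{1..}. \<Sum>\<^sub>\<infinity>k\<in>last_blocks n i. strict_term u n i k))"
proof -
  interpret blocks u n by unfold_locales (fact u_pos n_incr u_n)+
  show ?thesis
    unfolding block_overpartitions_eq block_partitions_eq block_strict_overpartitions_eq
  \<comment> \<open>The weak identity serves twice, with \<open>V\<close> true and false; what
    remains is the evaluation of the block and head fractions.\<close>
  proof (intro conjI[OF weak_identity conjI[OF weak_identity strict_identity]])
    show "over_block u m (qexp m) = (wvar True m (u m) + 1) * block_gf True m"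
      and "plain_block u m (qexp m) = (wvar False m (u m) + 1) * block_gf False m" if "m \<ge> 1" for m
      using over_block_eq plain_block_eq that by blast+
    show "over_head u n i = over_block u m (qexp m)" and "plain_head u n i = plain_block u m (qexp m)"
      if "i \<ge> 1" "n i = enat m" for i m
      using head_eqs that by blast+
  qed (simp_all add: over_head_def plain_head_def over_factor_def plain_factor_def)
qed

end
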